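(* Let $n\ge 2$ with prime factorization $n=\prod_j p_j^{a_j}$ (distinct primes $p_j$) and let $m=\min_j p_j^{a_j}$. Then the maximum $q$ such that there exists a simply transitive set of $q$ mutually orthogonal Latin squares of order $n$ equals $m-1$.
   Context: A set of $q$ MOLS of order $n$ is identified with an orthogonal array $(S,X_i,\pi_i)_{i=1}^{q+2}$: sets $X_i$ with $|X_i|=n$ and maps $\pi_i\colon S\to X_i$ such that $\pi_i\times\pi_j\colon S\to X_i\times X_j$ is a bijection for all $i\ne j$ (two coordinates index rows and columns, the rest give the symbols of the $q$ squares). Regarding $S\subset\prod_iX_i$ via $\prod_i\pi_i$, the autotopy group is $\{(\sigma_i)\in\prod_i\mathrm{Sym}(X_i):(\sigma_i)(S)=S\}$. The set of MOLS is simply transitive if some subgroup of its autotopy group acts simply transitively on $S$. *)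

theory Defs
  imports
    "HOL-Algebra.Bij"
    "HOL-Algebra.Product_Groups"
    "HOL-Computational_Algebra.Primes"
begin

definition orthogonal_array ::
  "nat \<Rightarrow> nat \<Rightarrow> 's set \<Rightarrow> (nat \<Rightarrow> 'x set) \<Rightarrow> (nat \<Rightarrow> 's \<Rightarrow> 'x) \<Rightarrow> bool"
  where "orthogonal_array k n S X \<pi> \<longleftrightarrow>
    (\<forall>i\<in>{1..k}. finite (X i) \<and> card (X i) = n \<and> \<pi> i \<in> S \<rightarrow> X i) \<and>
    (\<forall>i\<in>{1..k}. \<forall>j\<in>{1..k}. i \<noteq> j \<longrightarrow>
       bij_betw (\<lambda>s. (\<pi> i s, \<pi> j s)) S (X i \<times> X j))"

text \<open>The image of \<open>S\<close> in \<open>\<Prod>\<^sub>i X\<^sub>i\<close>; for \<open>k \<ge> 2\<close> the map \<open>\<Prod>\<^sub>i \<pi>\<^sub>i\<close> is injective on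
  \<open>S\<close>, so this is \<open>S\<close> regarded as a subset of the product.\<close>

definition oa_rows :: "nat \<Rightarrow> 's set \<Rightarrow> (nat \<Rightarrow> 's \<Rightarrow> 'x) \<Rightarrow> (nat \<Rightarrow> 'x) set"
  where "oa_rows k S \<pi> = (\<lambda>s. \<lambda>i\<in>{1..k}. \<pi> i s) ` S"

definition tuple_act :: "nat \<Rightarrow> (nat \<Rightarrow> 'x \<Rightarrow> 'x) \<Rightarrow> (nat \<Rightarrow> 'x) \<Rightarrow> (nat \<Rightarrow> 'x)"
  where "tuple_act k \<sigma> r = (\<lambda>i\<in>{1..k}. \<sigma> i (r i))"

definition autotopy_group ::
  "nat \<Rightarrow> 's set \<Rightarrow> (nat \<Rightarrow> 'x set) \<Rightarrow> (nat \<Rightarrow> 's \<Rightarrow> 'x) \<Rightarrow> (nat \<Rightarrow> 'x \<Rightarrow> 'x) monoid"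
  where "autotopy_group k S X \<pi> =
    (let P = product_group {1..k} (\<lambda>i. BijGroup (X i))
     in P\<lparr>carrier := {\<sigma> \<in> carrier P. tuple_act k \<sigma> ` oa_rows k S \<pi> = oa_rows k S \<pi>}\<rparr>)"

text \<open>A set of \<open>q\<close> mutually orthogonal Latin squares of order \<open>n\<close> is an orthogonal array
  with \<open>q + 2\<close> coordinates. That all \<open>X\<^sub>i\<close> live in one type is no restriction, since the \<open>X\<^sub>i\<close>
  are arbitrary, possibly disjoint, subsets of it.\<close>

definition simply_transitive_MOLS ::
  "nat \<Rightarrow> nat \<Rightarrow> 's set \<Rightarrow> (nat \<Rightarrow> 'x set) \<Rightarrow> (nat \<Rightarrow> 's \<Rightarrow> 'x) \<Rightarrow> bool"
  where "simply_transitive_MOLS q n S X \<pi> \<longleftrightarrow>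
    orthogonal_array (q + 2) n S X \<pi> \<and>
    (\<exists>H. subgroup H (autotopy_group (q + 2) S X \<pi>) \<and>
         (\<forall>r\<in>oa_rows (q + 2) S \<pi>. \<forall>t\<in>oa_rows (q + 2) S \<pi>.
            \<exists>!\<sigma>. \<sigma> \<in> H \<and> tuple_act (q + 2) \<sigma> r = t))"

end

theory Submission
  imports Defs "HOL-Algebra.Sylow" "HOL-Algebra.Group_Action" "Jordan_Normal_Form.Char_Poly"
begin

text \<open>
  Upper bound: let \<open>H\<close> act simply transitively on the \<open>n\<^sup>2\<close> rows, let \<open>p\<^sup>a\<close> be the exact power of \<open>p\<close>
  in \<open>n\<close>, and let \<open>P\<close> be a Sylow \<open>p\<close>-subgroup of \<open>H\<close>, so \<open>P\<close> has order \<open>p\<^sup>2\<^sup>a\<close>. Not all \<open>P\<close>-orbits on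
  the \<open>n\<close>-set \<open>X\<^sub>i\<close> have size divisible by \<open>p\<^sup>a\<^sup>+\<^sup>1\<close>, so some point stabilizer in \<open>P\<close> has order at
  least \<open>p\<^sup>a\<close>. An element that stabilizes points of \<open>X\<^sub>i\<close> and \<open>X\<^sub>j\<close> with \<open>i \<noteq> j\<close> fixes a row and
  hence is trivial. Counting non-identity elements of \<open>P\<close> gives
  \<open>(q + 2) (p\<^sup>a - 1) \<le> p\<^sup>2\<^sup>a - 1\<close>, i.e. \<open>q + 2 \<le> p\<^sup>a + 1\<close>.

  Lower bound: let \<open>R\<close> be the product of the fields of order \<open>p\<^sub>j\<close> to the \<open>a\<^sub>j\<close>. It contains \<open>m\<close> elements \<open>c\<close>
  with pairwise differences invertible, and \<open>R \<times> R\<close> acts by translations on the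
  array with coordinates \<open>c x + y\<close> and \<open>x\<close>. The field of order \<open>Q = p\<^sup>a\<close> is obtained as
  \<open>\<int>[\<zeta>] / M\<close> for a primitive complex \<open>(Q - 1)\<close>-th root of unity \<open>\<zeta>\<close> and a prime ideal \<open>M\<close>
  over \<open>p\<close>, with representatives \<open>0\<close> and the powers of \<open>\<zeta>\<close>.
\<close>

section \<open>The ring \<open>\<int>[\<zeta>]\<close>\<close>

definition zeta :: "nat \<Rightarrow> complex"
  where "zeta N = cis (2 * pi / real N)"

text \<open>All N powers serve as a spanning set, although for N > 1 they are linearly dependent.
  Closure under multiplication then follows from zeta^N = 1 alone, without the cyclotomic
  polynomial. For N = 0 the set is {0}, hence the assumption N > 0 below.\<close>

definition cyclotomic_ring :: "nat \<Rightarrow> complex set"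
  where "cyclotomic_ring N = range (\<lambda>c. \<Sum>i<N. of_int (c i) * zeta N ^ i)"

section \<open>Powers of zeta and the factorization of x^N - 1\<close>

lemma zeta_power: "zeta N ^ k = cis (2 * pi * real k / real N)"
  by (simp add: zeta_def Complex.DeMoivre mult_ac)

lemma zeta_power_N:
  assumes "N > 0"
  shows "zeta N ^ N = 1"
  using assms by (simp add: zeta_power)

lemma zeta_power_mod:
  assumes "N > 0"
  shows "zeta N ^ (k mod N) = zeta N ^ k"
proof -
  have "zeta N ^ k = zeta N ^ (N * (k div N) + k mod N)" by simp
  also have "\<dots> = zeta N ^ (k mod N)"
    using assms by (simp only: power_add power_mult zeta_power_N) simp
  finally show ?thesis by simp
qed

lemma bij_betw_zeta_power:
  assumes "N > 0"
  shows "bij_betw (\<lambda>k. zeta N ^ k) {..<N} {z. z ^ N = 1}"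
  using bij_betw_roots_unity[OF assms] by (simp add: zeta_power)

lemma zeta_power_neq_1:
  assumes "0 < j" "j < N"
  shows "zeta N ^ j \<noteq> 1"
proof
  assume "zeta N ^ j = 1"
  then have "zeta N ^ j = zeta N ^ 0" by simp
  moreover have "inj_on (\<lambda>k. zeta N ^ k) {..<N}"
    using bij_betw_zeta_power assms by (auto simp: bij_betw_def)
  ultimately show False
    using assms inj_onD[of "\<lambda>k. zeta N ^ k" "{..<N}" j 0] by auto
qed

text \<open>Both sides are monic of degree N in x and vanish at the N distinct powers of zeta. Their
  difference has degree below N, so N roots force it to be zero.\<close>

lemma prod_zeta:
  assumes "N > 0"
  shows "(\<Prod>j<N. x - zeta N ^ j) = x ^ N - 1"
proof -
  define P where "P = (\<Prod>j<N. [:- (zeta N ^ j), 1:])"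
  define Q where "Q = monom 1 N - (1 :: complex poly)"
  have inj: "inj_on (\<lambda>k. zeta N ^ k) {..<N}"
    using bij_betw_zeta_power assms by (auto simp: bij_betw_def)
  have P: "degree P = N" "lead_coeff P = 1"
    unfolding P_def by (subst degree_prod_eq_sum_degree; simp) (simp add: lead_coeff_prod)
  have Q: "degree Q = N" "coeff Q N = 1"
  proof -
    have "degree (monom (1::complex) N + (- 1)) = N"
      using assms by (subst degree_add_eq_left) (auto simp: degree_monom_eq)
    then show "degree Q = N" by (simp add: Q_def)
    show "coeff Q N = 1" unfolding Q_def using assms by simp
  qed
  have "P = Q"
  proof (rule ccontr)
    assume "P \<noteq> Q"
    then have nz: "P - Q \<noteq> 0" by simp
    have "degree (P - Q) \<le> N" using P Q by (intro degree_diff_le) auto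
    moreover have "coeff (P - Q) N = 0" using P Q by simp
    ultimately have lt: "degree (P - Q) < N"
      using nz by (metis leading_coeff_0_iff order_le_less)
    have "(\<lambda>k. zeta N ^ k) ` {..<N} \<subseteq> {x. poly (P - Q) x = 0}"
    proof (rule image_subsetI)
      fix k assume k: "k \<in> {..<N}"
      have "poly P (zeta N ^ k) = 0"
        unfolding P_def poly_prod using k by (intro prod_zero) auto
      moreover have "poly Q (zeta N ^ k) = 0"
        using zeta_power_N[OF assms]
        by (simp add: Q_def poly_monom flip: power_mult) (simp add: mult.commute[of k] power_mult)
      ultimately show "zeta N ^ k \<in> {x. poly (P - Q) x = 0}" by simp
    qed
    then have "card ((\<lambda>k. zeta N ^ k) ` {..<N}) \<le> card {x. poly (P - Q) x = 0}"
      using poly_roots_finite[OF nz] by (intro card_mono)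
    also have "\<dots> \<le> degree (P - Q)" using nz by (rule card_poly_roots_bound)
    finally show False using lt by (simp add: card_image inj)
  qed
  then have "poly P x = poly Q x" by simp
  then show ?thesis by (simp add: P_def Q_def poly_prod poly_monom)
qed

section \<open>Closure of \<open>cyclotomic_ring\<close> under the ring operations\<close>

lemma cyclotomic_ring_iff:
  "x \<in> cyclotomic_ring N \<longleftrightarrow> (\<exists>c. x = (\<Sum>i<N. of_int (c i) * zeta N ^ i))"
  by (auto simp: cyclotomic_ring_def)

lemma cyclotomic_ring_add:
  assumes "x \<in> cyclotomic_ring N" "y \<in> cyclotomic_ring N"
  shows "x + y \<in> cyclotomic_ring N"
proof -
  obtain c d where cd: "x = (\<Sum>i<N. of_int (c i) * zeta N ^ i)" "y = (\<Sum>i<N. of_int (d i) * zeta N ^ i)"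
    using assms by (auto simp: cyclotomic_ring_iff)
  show ?thesis unfolding cyclotomic_ring_iff
    by (rule exI[of _ "\<lambda>i. c i + d i"]) (simp add: cd sum.distrib ring_distribs)
qed

lemma cyclotomic_ring_of_int_mult:
  assumes "x \<in> cyclotomic_ring N"
  shows "of_int k * x \<in> cyclotomic_ring N"
proof -
  obtain c where c: "x = (\<Sum>i<N. of_int (c i) * zeta N ^ i)"
    using assms by (auto simp: cyclotomic_ring_iff)
  show ?thesis unfolding cyclotomic_ring_iff
    by (rule exI[of _ "\<lambda>i. k * c i"]) (simp add: c sum_distrib_left mult_ac)
qed

lemma cyclotomic_ring_0: "0 \<in> cyclotomic_ring N"
  unfolding cyclotomic_ring_iff by (rule exI[of _ "\<lambda>_. 0"]) simp

lemma cyclotomic_ring_uminus: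
  assumes "x \<in> cyclotomic_ring N"
  shows "- x \<in> cyclotomic_ring N"
  using cyclotomic_ring_of_int_mult[OF assms, of "-1"] by simp

lemma cyclotomic_ring_diff:
  assumes "x \<in> cyclotomic_ring N" "y \<in> cyclotomic_ring N"
  shows "x - y \<in> cyclotomic_ring N"
  using cyclotomic_ring_add[OF assms(1) cyclotomic_ring_uminus[OF assms(2)]] by simp

lemma cyclotomic_ring_sum:
  assumes "\<And>i. i \<in> I \<Longrightarrow> f i \<in> cyclotomic_ring N"
  shows "sum f I \<in> cyclotomic_ring N"
  using assms
  by (induction I rule: infinite_finite_induct) (auto intro: cyclotomic_ring_0 cyclotomic_ring_add)

text \<open>Exponents wrap around modulo N, so a single coefficient 1 at index k mod N represents
  the power.\<close>

lemma zeta_power_in_cyclotomic_ring: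
  assumes "N > 0"
  shows "zeta N ^ k \<in> cyclotomic_ring N"
proof -
  have "zeta N ^ k = (\<Sum>i<N. if i = k mod N then zeta N ^ i else 0)"
    using assms by (simp add: zeta_power_mod)
  also have "\<dots> = (\<Sum>i<N. of_int (if i = k mod N then 1 else 0) * zeta N ^ i)"
    by (intro sum.cong) auto
  finally show ?thesis
    unfolding cyclotomic_ring_iff by (rule exI[of _ "\<lambda>i. if i = k mod N then 1 else 0"])
qed

lemma cyclotomic_ring_mult:
  assumes "N > 0" "x \<in> cyclotomic_ring N" "y \<in> cyclotomic_ring N"
  shows "x * y \<in> cyclotomic_ring N"
proof -
  obtain c d where cd: "x = (\<Sum>i<N. of_int (c i) * zeta N ^ i)" "y = (\<Sum>i<N. of_int (d i) * zeta N ^ i)"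
    using assms by (auto simp: cyclotomic_ring_iff)
  have "x * y = (\<Sum>i<N. \<Sum>j<N. of_int (c i * d j) * zeta N ^ (i + j))"
    by (simp add: cd sum_product power_add mult_ac)
  also have "\<dots> \<in> cyclotomic_ring N"
    by (intro cyclotomic_ring_sum cyclotomic_ring_of_int_mult zeta_power_in_cyclotomic_ring assms)
  finally show ?thesis .
qed

lemma cyclotomic_ring_1:
  assumes "N > 0"
  shows "1 \<in> cyclotomic_ring N"
  using zeta_power_in_cyclotomic_ring[OF assms, of 0] by simp

lemma cyclotomic_ring_of_int:
  assumes "N > 0"
  shows "of_int k \<in> cyclotomic_ring N"
  using cyclotomic_ring_of_int_mult[OF cyclotomic_ring_1[OF assms], of k] by simp

lemma cyclotomic_ring_power:
  assumes "N > 0" "x \<in> cyclotomic_ring N"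
  shows "x ^ k \<in> cyclotomic_ring N"
  using assms by (induction k) (auto intro: cyclotomic_ring_1 cyclotomic_ring_mult)

text \<open>Multiplication by an element of \<open>\<int>[\<zeta>]\<close> is an integer matrix in the spanning set
  \<open>\<zeta>\<^sup>0, \<dots>, \<zeta>\<^sup>N\<^sup>-\<^sup>1\<close>, so the element is a root of a monic characteristic polynomial.\<close>

lemma algebraic_int_cyclotomic_ring:
  assumes N: "N > 0" and x: "x \<in> cyclotomic_ring N"
  shows "algebraic_int x"
proof -
  have "\<forall>i. \<exists>c. x * zeta N ^ i = (\<Sum>j<N. of_int (c j) * zeta N ^ j)"
    using cyclotomic_ring_mult[OF N x zeta_power_in_cyclotomic_ring[OF N]]
    by (simp add: cyclotomic_ring_iff)
  then obtain c where c: "\<And>i. x * zeta N ^ i = (\<Sum>j<N. of_int (c i j) * zeta N ^ j)"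
    by metis
  define B :: "int mat" where "B = mat N N (\<lambda>(i, j). c i j)"
  define v where "v = vec N (\<lambda>i. zeta N ^ i)"
  have B: "B \<in> carrier_mat N N" by (simp add: B_def)
  have "eigenvector (map_mat of_int B) v x"
    unfolding eigenvector_def
  proof (intro conjI)
    show "v \<in> carrier_vec (dim_row (map_mat of_int B))" by (simp add: v_def B_def)
    \<comment> \<open>The entry at index 0 is zeta^0 = 1, so the vector is nonzero.\<close>
    have "v $ 0 \<noteq> 0\<^sub>v N $ 0" using N by (simp add: v_def)
    then show "v \<noteq> 0\<^sub>v (dim_row (map_mat of_int B))" by (auto simp: B_def)
    show "map_mat of_int B *\<^sub>v v = x \<cdot>\<^sub>v v"
    proof (rule eq_vecI)
      show "dim_vec (map_mat of_int B *\<^sub>v v) = dim_vec (x \<cdot>\<^sub>v v)" by (simp add: v_def B_def)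
      fix i assume "i < dim_vec (x \<cdot>\<^sub>v v)"
      then have i: "i < N" by (simp add: v_def)
      then show "(map_mat of_int B *\<^sub>v v) $ i = (x \<cdot>\<^sub>v v) $ i"
        by (simp add: v_def B_def scalar_prod_def c lessThan_atLeast0)
    qed
  qed
  then have "poly (char_poly (map_mat of_int B)) x = 0"
    using eigenvalue_root_char_poly[of "map_mat of_int B" N x] B
    by (auto simp: eigenvalue_def)
  then have "poly (map_poly of_int (char_poly B)) x = 0"
    by (simp add: of_int_hom.char_poly_hom[OF B])
  moreover have "lead_coeff (char_poly B) = 1" using degree_monic_char_poly[OF B] by simp
  ultimately show ?thesis unfolding algebraic_int_altdef_ipoly by blast
qed

section \<open>Prime ideals over p\<close>

lemma inverse_prime_notin_cyclotomic_ring: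
  fixes p :: nat
  assumes "N > 0" "prime p"
  shows "1 / of_nat p \<notin> cyclotomic_ring N"
proof
  assume "1 / of_nat p \<in> cyclotomic_ring N"
  then have "algebraic_int (1 / of_nat p :: complex)"
    using algebraic_int_cyclotomic_ring assms by blast
  then have "(1 / of_nat p :: complex) \<in> \<int>"
    by (rule rational_algebraic_int_is_int) simp
  then obtain k :: int where k: "(1 / of_nat p :: complex) = of_int k" by (auto elim: Ints_cases)
  have "(of_int (k * int p) :: complex) = of_int 1"
    using k prime_gt_0_nat[OF assms(2)] by (simp add: field_simps)
  then have "k * int p = 1" by (simp only: of_int_eq_iff)
  then have "int p dvd 1" by (metis dvd_triv_right)
  then show False using prime_gt_1_nat[OF assms(2)] by simp
qed

text \<open>The ring is a bare set of complex numbers, so the ideal axioms are spelled out. For N >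
  0, negatives come from multiplication by -1.\<close>

definition cyclotomic_ideal :: "nat \<Rightarrow> complex set \<Rightarrow> bool"
  where "cyclotomic_ideal N I \<longleftrightarrow> I \<subseteq> cyclotomic_ring N \<and> 0 \<in> I \<and>
    (\<forall>x\<in>I. \<forall>y\<in>I. x + y \<in> I) \<and> (\<forall>x\<in>I. \<forall>r\<in>cyclotomic_ring N. r * x \<in> I)"

text \<open>Zorn's lemma yields an ideal that is maximal among those containing p but not 1, and
  such an ideal is prime.\<close>

lemma exists_prime_ideal_over:
  fixes p :: nat
  assumes N: "N > 0" and p: "prime p"
  obtains M where "cyclotomic_ideal N M" "of_nat p \<in> M" "1 \<notin> M"
    "\<And>x y. \<lbrakk>x \<in> cyclotomic_ring N; y \<in> cyclotomic_ring N; x * y \<in> M\<rbrakk> \<Longrightarrow> x \<in> M \<or> y \<in> M"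
proof -
  define \<I> where "\<I> = {I. cyclotomic_ideal N I \<and> of_nat p \<in> I \<and> 1 \<notin> I}"
  \<comment> \<open>The principal ideal generated by p is a starting point: it is proper because 1/p
    is not in the ring.\<close>
  have "(\<lambda>x. of_nat p * x) ` cyclotomic_ring N \<in> \<I>"
  proof -
    have "(\<lambda>x. of_nat p * x) ` cyclotomic_ring N \<subseteq> cyclotomic_ring N"
      using cyclotomic_ring_of_int_mult[of _ N "int p"] by auto
    moreover have "of_nat p * x + of_nat p * y \<in> (\<lambda>x. of_nat p * x) ` cyclotomic_ring N"
      if "x \<in> cyclotomic_ring N" "y \<in> cyclotomic_ring N" for x y
      using cyclotomic_ring_add[OF that] by (metis distrib_left imageI)
    moreover have "r * (of_nat p * x) \<in> (\<lambda>x. of_nat p * x) ` cyclotomic_ring N"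
      if "x \<in> cyclotomic_ring N" "r \<in> cyclotomic_ring N" for x r
      using cyclotomic_ring_mult[OF N that] by (metis mult.commute mult.assoc imageI)
    moreover have "1 \<noteq> of_nat p * x" if "x \<in> cyclotomic_ring N" for x
    proof
      assume "1 = of_nat p * x"
      then have "x = 1 / of_nat p" using prime_gt_0_nat[OF p] by (simp add: field_simps)
      then show False using inverse_prime_notin_cyclotomic_ring[OF N p] that by simp
    qed
    moreover have "0 \<in> (\<lambda>x. of_nat p * x) ` cyclotomic_ring N"
      using cyclotomic_ring_0 by force
    moreover have "of_nat p \<in> (\<lambda>x. of_nat p * x) ` cyclotomic_ring N"
      using cyclotomic_ring_1[OF N] by force
    ultimately show ?thesis
      unfolding \<I>_def cyclotomic_ideal_def by (simp only: mem_Collect_eq) blast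
  qed
  then have "\<I> \<noteq> {}" by blast
  moreover have "\<Union>\<C> \<in> \<I>" if ne: "\<C> \<noteq> {}" and ch: "subset.chain \<I> \<C>" for \<C>
  proof -
    have sub: "I \<in> \<I>" if "I \<in> \<C>" for I
      using ch that unfolding subset.chain_def by blast
    have "x + y \<in> \<Union>\<C>" if "x \<in> \<Union>\<C>" "y \<in> \<Union>\<C>" for x y
    proof -
      obtain I J where IJ: "I \<in> \<C>" "x \<in> I" "J \<in> \<C>" "y \<in> J" using \<open>x \<in> \<Union>\<C>\<close> \<open>y \<in> \<Union>\<C>\<close> by blast
      have "I \<subseteq> J \<or> J \<subseteq> I" using ch IJ unfolding subset_chain_def by blast
      then obtain K where "K \<in> \<C>" "x \<in> K" "y \<in> K" using IJ by blast
      then show ?thesis using sub[of K] unfolding \<I>_def cyclotomic_ideal_def by blast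
    qed
    moreover have "r * x \<in> \<Union>\<C>" if "x \<in> \<Union>\<C>" "r \<in> cyclotomic_ring N" for x r
      using sub that unfolding \<I>_def cyclotomic_ideal_def by blast
    moreover have "\<Union>\<C> \<subseteq> cyclotomic_ring N"
      using sub unfolding \<I>_def cyclotomic_ideal_def by blast
    moreover have "1 \<notin> \<Union>\<C>"
      using sub unfolding \<I>_def by blast
    moreover have "0 \<in> \<Union>\<C>" "of_nat p \<in> \<Union>\<C>"
      using sub ne unfolding \<I>_def cyclotomic_ideal_def by blast+
    ultimately show ?thesis
      unfolding \<I>_def cyclotomic_ideal_def mem_Collect_eq by (intro conjI ballI)
  qed
  ultimately have "\<exists>M\<in>\<I>. \<forall>X\<in>\<I>. M \<subseteq> X \<longrightarrow> X = M" by (rule subset_Zorn_nonempty)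
  then obtain M where M: "M \<in> \<I>" and max: "\<And>X. \<lbrakk>X \<in> \<I>; M \<subseteq> X\<rbrakk> \<Longrightarrow> X = M" by blast
  have id: "cyclotomic_ideal N M" "of_nat p \<in> M" "1 \<notin> M" using M by (auto simp: \<I>_def)
  have prime: "y \<in> M"
    if x: "x \<in> cyclotomic_ring N" and y: "y \<in> cyclotomic_ring N" and xy: "x * y \<in> M" and nx: "x \<notin> M" for x y
  proof -
    \<comment> \<open>\<open>J\<close> is the ideal generated by \<open>M\<close> and
      \<open>x\<close>. It is strictly larger than \<open>M\<close>, so by maximality it contains 1;
      multiplying 1 = m + r x by y puts y into \<open>M\<close>.\<close>
    define J where "J = {m + r * x | m r. m \<in> M \<and> r \<in> cyclotomic_ring N}"
    have MJ: "M \<subseteq> J"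
      unfolding J_def using cyclotomic_ring_0 by force
    have "0 + 1 * x \<in> J"
      unfolding J_def mem_Collect_eq using cyclotomic_ring_1[OF N] id(1)
      unfolding cyclotomic_ideal_def by blast
    then have "J \<noteq> M" using nx by auto
    then have "J \<notin> \<I>" using max MJ by blast
    moreover have "cyclotomic_ideal N J"
      unfolding cyclotomic_ideal_def
    proof (intro conjI ballI)
      show "J \<subseteq> cyclotomic_ring N"
        using id(1) x N unfolding J_def cyclotomic_ideal_def
        by (auto intro!: cyclotomic_ring_add cyclotomic_ring_mult)
      show "0 \<in> J" using MJ id(1) by (auto simp: cyclotomic_ideal_def)
    next
      fix u v assume "u \<in> J" "v \<in> J"
      then obtain m r m' r' where *: "m \<in> M" "m' \<in> M" "r \<in> cyclotomic_ring N" "r' \<in> cyclotomic_ring N"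
        "u = m + r * x" "v = m' + r' * x" unfolding J_def by blast
      then have "u + v = (m + m') + (r + r') * x" by (simp add: algebra_simps)
      moreover have "m + m' \<in> M" "r + r' \<in> cyclotomic_ring N"
        using * id(1) by (auto simp: cyclotomic_ideal_def cyclotomic_ring_add)
      ultimately show "u + v \<in> J" unfolding J_def by blast
    next
      fix u s assume "u \<in> J" and s: "s \<in> cyclotomic_ring N"
      then obtain m r where *: "m \<in> M" "r \<in> cyclotomic_ring N" "u = m + r * x"
        unfolding J_def by blast
      then have "s * u = s * m + (s * r) * x" by (simp add: algebra_simps)
      moreover have "s * m \<in> M" "s * r \<in> cyclotomic_ring N"
        using * s id(1) N by (auto simp: cyclotomic_ideal_def cyclotomic_ring_mult)
      ultimately show "s * u \<in> J" unfolding J_def by blast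
    qed
    ultimately have "1 \<in> J" using id(2) MJ by (auto simp: \<I>_def)
    then obtain m r where mr: "m \<in> M" "r \<in> cyclotomic_ring N" "1 = m + r * x"
      unfolding J_def by blast
    have "y = (m + r * x) * y" by (simp flip: mr(3))
    also have "\<dots> = y * m + r * (x * y)" by (simp add: algebra_simps)
    also have "\<dots> \<in> M" using mr xy y id(1) by (auto simp: cyclotomic_ideal_def)
    finally show ?thesis .
  qed
  show ?thesis using that id prime by blast
qed

section \<open>Finite fields as residue fields\<close>

text \<open>The choice N = p^a - 1 gives zeta the order of the unit group of a field with p^a
  elements. The aim is that Z[zeta] has exactly p^a classes modulo the prime ideal
  \<open>M\<close>.\<close>

locale residue_field =
  fixes p a N :: nat and M :: "complex set"
  assumes prime_p: "prime p" and a_pos: "a > 0" and Suc_N: "Suc N = p ^ a"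
    and ideal_M: "cyclotomic_ideal N M" and p_in_M: "of_nat p \<in> M" and one_notin_M: "1 \<notin> M"
    and prime_M: "\<And>x y. \<lbrakk>x \<in> cyclotomic_ring N; y \<in> cyclotomic_ring N; x * y \<in> M\<rbrakk> \<Longrightarrow> x \<in> M \<or> y \<in> M"
begin

lemma N_pos: "N > 0"
proof -
  have "p ^ 1 \<le> p ^ a" using a_pos prime_gt_0_nat[OF prime_p] by (intro power_increasing) auto
  then show ?thesis using Suc_N prime_ge_2_nat[OF prime_p] by simp
qed

abbreviation A where "A \<equiv> cyclotomic_ring N"

lemmas A_intros = cyclotomic_ring_0 cyclotomic_ring_1[OF N_pos] cyclotomic_ring_add
  cyclotomic_ring_diff cyclotomic_ring_uminus cyclotomic_ring_mult[OF N_pos]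
  cyclotomic_ring_power[OF N_pos] zeta_power_in_cyclotomic_ring[OF N_pos] cyclotomic_ring_sum

lemma of_nat_in_A: "of_nat k \<in> A"
  using cyclotomic_ring_of_int[OF N_pos, of "int k"] by simp

lemma M_0: "0 \<in> M"
  and M_add: "\<lbrakk>x \<in> M; y \<in> M\<rbrakk> \<Longrightarrow> x + y \<in> M"
  and M_mult: "\<lbrakk>x \<in> M; r \<in> A\<rbrakk> \<Longrightarrow> r * x \<in> M"
  using ideal_M by (auto simp: cyclotomic_ideal_def)

lemma M_uminus: "x \<in> M \<Longrightarrow> - x \<in> M"
  using M_mult[of x "- 1"] by (simp add: A_intros)

lemma M_sum: "(\<And>i. i \<in> I \<Longrightarrow> f i \<in> M) \<Longrightarrow> sum f I \<in> M"
  by (induction I rule: infinite_finite_induct) (auto intro: M_0 M_add)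

section \<open>Congruence modulo M and the Frobenius map\<close>

definition cong_M :: "complex \<Rightarrow> complex \<Rightarrow> bool"  (infix "\<cong>\<^sub>M" 50)
  where "x \<cong>\<^sub>M y \<longleftrightarrow> x - y \<in> M"

lemma cong_refl [simp]: "x \<cong>\<^sub>M x"
  by (simp add: cong_M_def M_0)

lemma cong_sym: "x \<cong>\<^sub>M y \<Longrightarrow> y \<cong>\<^sub>M x"
  using M_uminus[of "x - y"] by (simp add: cong_M_def)

lemma cong_trans [trans]: "\<lbrakk>x \<cong>\<^sub>M y; y \<cong>\<^sub>M z\<rbrakk> \<Longrightarrow> x \<cong>\<^sub>M z"
  using M_add[of "x - y" "y - z"] by (simp add: cong_M_def)

lemma cong_add: "\<lbrakk>x \<cong>\<^sub>M y; u \<cong>\<^sub>M v\<rbrakk> \<Longrightarrow> x + u \<cong>\<^sub>M y + v"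
  using M_add[of "x - y" "u - v"] by (simp add: cong_M_def algebra_simps)

lemma cong_mult_left: "\<lbrakk>x \<cong>\<^sub>M y; r \<in> A\<rbrakk> \<Longrightarrow> r * x \<cong>\<^sub>M r * y"
  using M_mult[of "x - y" r] by (simp add: cong_M_def algebra_simps)

text \<open>In the ring, x - y divides x^k - y^k.\<close>

lemma cong_power:
  assumes "x \<cong>\<^sub>M y" "x \<in> A" "y \<in> A"
  shows "x ^ k \<cong>\<^sub>M y ^ k"
proof -
  have "(\<Sum>i<k. y ^ (k - Suc i) * x ^ i) * (x - y) \<in> M"
    using assms by (intro M_mult A_intros) (auto simp: cong_M_def)
  then show ?thesis
    by (simp add: cong_M_def power_diff_sumr2 mult.commute)
qed

text \<open>The binomial coefficients strictly between the two ends are divisible by p, which lies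
  in \<open>M\<close>.\<close>

lemma cong_power_p:
  assumes x: "x \<in> A" and y: "y \<in> A"
  shows "(x + y) ^ p \<cong>\<^sub>M x ^ p + y ^ p"
proof -
  have p2: "p \<ge> 2" using prime_p by (rule prime_ge_2_nat)
  define h where "h k = of_nat (p choose k) * x ^ k * y ^ (p - k)" for k
  have "{..p} = insert 0 (insert p {1..<p})" using p2 by auto
  then have "(x + y) ^ p = h 0 + (h p + sum h {1..<p})"
    using p2 unfolding binomial_ring h_def by simp
  then have "(x + y) ^ p - (x ^ p + y ^ p) = sum h {1..<p}"
    by (simp add: h_def)
  also have "\<dots> \<in> M"
  proof (rule M_sum)
    fix k assume "k \<in> {1..<p}"
    then have "p dvd (p choose k)" using prime_p by (intro dvd_choose_prime) auto
    then obtain c where "p choose k = p * c" by (auto elim: dvdE)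
    then have "h k = (of_nat c * x ^ k * y ^ (p - k)) * of_nat p" by (simp add: h_def mult_ac)
    also have "\<dots> \<in> M" by (intro M_mult p_in_M A_intros x y of_nat_in_A)
    finally show "h k \<in> M" .
  qed
  finally show ?thesis by (simp add: cong_M_def)
qed

lemma cong_power_p_power:
  assumes x: "x \<in> A" and y: "y \<in> A"
  shows "(x + y) ^ (p ^ k) \<cong>\<^sub>M x ^ (p ^ k) + y ^ (p ^ k)"
proof (induction k)
  case (Suc k)
  have "(x + y) ^ (p ^ Suc k) = ((x + y) ^ (p ^ k)) ^ p"
    by (simp add: mult.commute flip: power_mult)
  also have "\<dots> \<cong>\<^sub>M (x ^ (p ^ k) + y ^ (p ^ k)) ^ p"
    by (rule cong_power[OF Suc.IH]) (intro A_intros x y)+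
  also have "\<dots> \<cong>\<^sub>M (x ^ (p ^ k)) ^ p + (y ^ (p ^ k)) ^ p"
    by (intro cong_power_p A_intros x y)
  also have "\<dots> = x ^ (p ^ Suc k) + y ^ (p ^ Suc k)"
    by (simp add: mult.commute flip: power_mult)
  finally show ?case .
qed simp

lemma frobenius_add:
  assumes "x \<in> A" "y \<in> A" "x ^ (p ^ a) \<cong>\<^sub>M x" "y ^ (p ^ a) \<cong>\<^sub>M y"
  shows "(x + y) ^ (p ^ a) \<cong>\<^sub>M x + y"
  using cong_power_p_power[OF assms(1,2)] cong_add[OF assms(3,4)] by (rule cong_trans)

lemma frobenius_0: "0 ^ (p ^ a) \<cong>\<^sub>M 0"
  using Suc_N by (simp flip: Suc_N)

lemma frobenius_of_nat_mult:
  assumes "x \<in> A" "x ^ (p ^ a) \<cong>\<^sub>M x"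
  shows "(of_nat k * x) ^ (p ^ a) \<cong>\<^sub>M of_nat k * x"
proof (induction k)
  case 0
  then show ?case using frobenius_0 by simp
next
  case (Suc k)
  have "(x + of_nat k * x) ^ (p ^ a) \<cong>\<^sub>M x + of_nat k * x"
    by (intro frobenius_add assms A_intros of_nat_in_A Suc)
  then show ?case by (simp add: algebra_simps)
qed

text \<open>Replacing the coefficient by its remainder modulo p changes the product by an element of
  \<open>M\<close>. This reduces negative coefficients to the natural ones.\<close>

lemma frobenius_of_int_mult:
  assumes "x \<in> A" "x ^ (p ^ a) \<cong>\<^sub>M x"
  shows "(of_int k * x) ^ (p ^ a) \<cong>\<^sub>M of_int k * x"
proof -
  define m where "m = nat (k mod int p)"
  have "int m = k mod int p"
    using prime_gt_0_nat[OF prime_p] by (simp add: m_def)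
  then have "k = int m + int p * (k div int p)" by simp
  then have "of_int k * x = of_nat m * x + of_int (k div int p) * x * of_nat p"
    by (metis (no_types, lifting) distrib_right mult.commute mult.left_commute of_int_add of_int_mult of_int_of_nat_eq)
  moreover have "of_int (k div int p) * x * of_nat p \<in> M"
    by (intro M_mult p_in_M A_intros assms cyclotomic_ring_of_int N_pos)
  ultimately have km: "of_int k * x \<cong>\<^sub>M of_nat m * x" by (simp add: cong_M_def)
  have "(of_int k * x) ^ (p ^ a) \<cong>\<^sub>M (of_nat m * x) ^ (p ^ a)"
    by (intro cong_power km A_intros assms of_nat_in_A cyclotomic_ring_of_int N_pos)
  also have "\<dots> \<cong>\<^sub>M of_nat m * x" using assms by (rule frobenius_of_nat_mult)
  also have "\<dots> \<cong>\<^sub>M of_int k * x" using km by (rule cong_sym)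
  finally show ?thesis .
qed

lemma frobenius_zeta: "(zeta N ^ i) ^ (p ^ a) = zeta N ^ i"
proof -
  have "(zeta N ^ i) ^ Suc N = zeta N ^ i * (zeta N ^ N) ^ i"
    by (simp add: mult.commute flip: power_mult)
  then show ?thesis by (simp add: zeta_power_N N_pos Suc_N)
qed

text \<open>The elements fixed by the p^a-th power modulo \<open>M\<close> include the powers of
  zeta and are closed under sums and integer multiples, so they fill the ring.\<close>

lemma frobenius:
  assumes "x \<in> A"
  shows "x ^ (p ^ a) \<cong>\<^sub>M x"
proof -
  obtain c where c: "x = (\<Sum>i<N. of_int (c i) * zeta N ^ i)"
    using assms by (auto simp: cyclotomic_ring_iff)
  have "(\<Sum>i\<in>I. of_int (c i) * zeta N ^ i) ^ (p ^ a) \<cong>\<^sub>M (\<Sum>i\<in>I. of_int (c i) * zeta N ^ i)"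
    if "finite I" for I :: "nat set"
    using that
  proof induction
    case empty
    then show ?case using frobenius_0 by simp
  next
    case (insert j I)
    have "(of_int (c j) * zeta N ^ j) ^ (p ^ a) \<cong>\<^sub>M of_int (c j) * zeta N ^ j"
      by (intro frobenius_of_int_mult A_intros) (simp add: frobenius_zeta)
    then show ?case
      using insert
      by (auto intro!: frobenius_add A_intros cyclotomic_ring_of_int N_pos)
  qed
  then show ?thesis by (simp add: c)
qed

section \<open>A complete system of representatives modulo M\<close>

lemma prime_M_prod:
  assumes "finite I" "\<And>i. i \<in> I \<Longrightarrow> f i \<in> A" "prod f I \<in> M"
  shows "\<exists>i\<in>I. f i \<in> M"
  using assms
proof (induction I)
  case empty
  then show ?case using one_notin_M by simp
next
  case (insert j I)
  have "prod f I \<in> A"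
    using insert.prems(1)
    by (induction I rule: infinite_finite_induct) (auto intro: A_intros)
  then show ?case using insert prime_M[of "f j" "prod f I"] by auto
qed

text \<open>These are the Teichmueller representatives. Taking them in place of cosets keeps the
  carrier of the residue field a set of complex numbers.\<close>

definition residues :: "complex set"
  where "residues = insert 0 ((\<lambda>j. zeta N ^ j) ` {..<N})"

lemma residues_A: "x \<in> residues \<Longrightarrow> x \<in> A"
  by (auto simp: residues_def intro: A_intros)

text \<open>With \<open>Q = p\<^sup>a\<close>, the number \<open>x\<^sup>Q - x = x \<Prod>\<^sub>j (x - \<zeta>\<^sup>j)\<close> lies in the prime ideal \<open>M\<close> by the
  Frobenius congruence, so one of its factors does.\<close>

lemma exists_residue:
  assumes x: "x \<in> A"
  shows "\<exists>y\<in>residues. x \<cong>\<^sub>M y"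
proof -
  have "x * (\<Prod>j<N. x - zeta N ^ j) = x ^ (p ^ a) - x"
    by (simp add: prod_zeta N_pos right_diff_distrib flip: Suc_N)
  then have "x * (\<Prod>j<N. x - zeta N ^ j) \<in> M"
    using frobenius[OF x] by (simp add: cong_M_def)
  moreover have "(\<Prod>j<N. x - zeta N ^ j) \<in> A"
    unfolding prod_zeta[OF N_pos] by (intro A_intros x)
  ultimately consider "x \<in> M" | "(\<Prod>j<N. x - zeta N ^ j) \<in> M"
    using prime_M x by blast
  then show ?thesis
  proof cases
    case 1
    then show ?thesis by (auto simp: residues_def cong_M_def)
  next
    case 2
    then have "\<exists>j\<in>{..<N}. x - zeta N ^ j \<in> M"
      by (intro prime_M_prod) (auto intro: A_intros x)
    then show ?thesis by (auto simp: residues_def cong_M_def)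
  qed
qed

text \<open>Each power of zeta is a unit whose inverse is again a power of zeta, so it cannot lie in
  a proper ideal.\<close>

lemma zeta_notin_M: "zeta N ^ j \<notin> M"
proof
  assume "zeta N ^ j \<in> M"
  then have "zeta N ^ (N * j - j) * zeta N ^ j \<in> M" by (intro M_mult A_intros)
  moreover have "zeta N ^ (N * j - j) * zeta N ^ j = zeta N ^ (N * j)"
    using N_pos by (simp flip: power_add)
  ultimately show False
    using one_notin_M by (simp add: power_mult zeta_power_N N_pos)
qed

text \<open>Cancelling the unit zeta^i leaves some \<xi> \<noteq> 1 with \<xi>^N = 1 and \<xi>
  congruent to 1. The geometric sum of \<xi> is 0 but also congruent to N, so N lies in
  \<open>M\<close>. Since N + 1 = p^a lies there too, so does 1.\<close>

lemma zeta_not_cong: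
  assumes "i < j" "j < N"
  shows "\<not> zeta N ^ j \<cong>\<^sub>M zeta N ^ i"
proof
  assume "zeta N ^ j \<cong>\<^sub>M zeta N ^ i"
  moreover define d where "d = j - i"
  moreover have "zeta N ^ j - zeta N ^ i = zeta N ^ i * (zeta N ^ d - 1)"
    using assms by (simp add: d_def right_diff_distrib flip: power_add)
  ultimately have M: "zeta N ^ d - 1 \<in> M"
    using prime_M[of "zeta N ^ i" "zeta N ^ d - 1"] zeta_notin_M[of i]
    by (auto simp: cong_M_def intro: A_intros)
  define \<xi> where "\<xi> = zeta N ^ d"
  have "\<xi> \<noteq> 1" unfolding \<xi>_def using assms by (intro zeta_power_neq_1) (auto simp: d_def)
  moreover have "\<xi> ^ N = 1"
    unfolding \<xi>_def by (metis N_pos mult.commute power_mult power_one zeta_power_N)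
  ultimately have "(\<Sum>k<N. \<xi> ^ k) = 0" by (simp add: geometric_sum)
  moreover have "(\<Sum>k<N. \<xi> ^ k - 1 ^ k) \<in> M"
    using cong_power[of \<xi> 1] M
    by (intro M_sum) (auto simp: cong_M_def \<xi>_def intro: A_intros)
  ultimately have "- of_nat N \<in> M" by (simp add: sum_subtractf)
  moreover have "of_nat (p ^ (a - 1)) * of_nat p \<in> M"
    by (intro M_mult p_in_M of_nat_in_A)
  then have "of_nat (Suc N) \<in> M"
    using a_pos by (simp add: Suc_N power_eq_if mult.commute flip: of_nat_mult)
  ultimately have "of_nat (Suc N) + - of_nat N \<in> M" by (intro M_add)
  then show False using one_notin_M by simp
qed

lemma residues_unique:
  assumes "x \<in> residues" "y \<in> residues" "x \<cong>\<^sub>M y"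
  shows "x = y"
proof -
  have "zeta N ^ i = zeta N ^ j" if "i < N" "j < N" "zeta N ^ i \<cong>\<^sub>M zeta N ^ j" for i j
    using zeta_not_cong[of i j] zeta_not_cong[of j i] that cong_sym
    by (cases i j rule: linorder_cases) auto
  moreover have "\<not> zeta N ^ i \<cong>\<^sub>M 0" "\<not> 0 \<cong>\<^sub>M zeta N ^ i" for i
    using zeta_notin_M[of i] cong_sym[of 0 "zeta N ^ i"] by (auto simp: cong_M_def)
  ultimately show ?thesis using assms by (auto simp: residues_def)
qed

lemma card_residues: "card residues = p ^ a"
proof -
  have "inj_on (\<lambda>k. zeta N ^ k) {..<N}"
    using bij_betw_zeta_power[OF N_pos] by (auto simp: bij_betw_def)
  moreover have "0 \<notin> (\<lambda>j. zeta N ^ j) ` {..<N}" using zeta_notin_M M_0 by (metis imageE)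
  ultimately show ?thesis by (simp add: residues_def card_image Suc_N)
qed

section \<open>Reduction to representatives and the additive group of the residue field\<close>

definition red :: "complex \<Rightarrow> complex"
  where "red x = (THE y. y \<in> residues \<and> x \<cong>\<^sub>M y)"

lemma red_eqI:
  assumes "y \<in> residues" "x \<cong>\<^sub>M y"
  shows "red x = y"
  unfolding red_def using assms
  by (intro the_equality) (auto intro: residues_unique cong_trans dest: cong_sym)

lemma red_residues: "x \<in> A \<Longrightarrow> red x \<in> residues"
  using exists_residue red_eqI by metis

lemma cong_red: "x \<in> A \<Longrightarrow> x \<cong>\<^sub>M red x"
  using exists_residue red_eqI by metis

lemma red_A: "x \<in> A \<Longrightarrow> red x \<in> A"
  by (simp add: residues_A red_residues)

lemma red_cong:
  assumes "x \<cong>\<^sub>M y" "y \<in> A"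
  shows "red x = red y"
  using assms by (intro red_eqI red_residues cong_trans[OF assms(1)] cong_red)

lemma red_id: "x \<in> residues \<Longrightarrow> red x = x"
  by (rule red_eqI) auto

lemma red_add_left: "\<lbrakk>x \<in> A; y \<in> A\<rbrakk> \<Longrightarrow> red (red x + y) = red (x + y)"
  and red_add_right: "\<lbrakk>x \<in> A; y \<in> A\<rbrakk> \<Longrightarrow> red (x + red y) = red (x + y)"
  and red_mult_right: "\<lbrakk>x \<in> A; y \<in> A\<rbrakk> \<Longrightarrow> red (x * red y) = red (x * y)"
  by (auto intro!: red_cong cong_add cong_mult_left cong_sym[OF cong_red] A_intros)

text \<open>Only addition becomes a group operation. Multiplication enters later through the
  endomorphisms x -> c x.\<close>

definition residue_group :: "complex monoid"
  where "residue_group = \<lparr>carrier = residues, monoid.mult = (\<lambda>x y. red (x + y)), one = 0\<rparr>"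

lemma comm_group_residue_group: "comm_group residue_group"
proof (rule comm_groupI)
  fix x assume "x \<in> carrier residue_group"
  then have x: "x \<in> A" by (simp add: residue_group_def residues_A)
  have "red (red (- x) + x) = 0"
    using x red_id[of 0] by (simp add: red_add_left A_intros) (simp add: residues_def)
  moreover have "red (- x) \<in> residues" using x by (intro red_residues A_intros)
  ultimately show "\<exists>y\<in>carrier residue_group. y \<otimes>\<^bsub>residue_group\<^esub> x = \<one>\<^bsub>residue_group\<^esub>"
    by (auto simp: residue_group_def)
qed (auto simp: residue_group_def red_add_left red_add_right residues_A A_intros red_id add_ac
       intro: red_residues, auto simp: residues_def)

end

text \<open>A group-theoretic substitute for m ring elements with pairwise invertible differences:
  \<open>f c\<close> plays the role of multiplication by the c-th element, and the difference of two
  of these maps has trivial kernel. This form passes to products without any ring structure.\<close>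

definition separating_endos :: "('g, 'b) monoid_scheme \<Rightarrow> nat \<Rightarrow> (nat \<Rightarrow> 'g \<Rightarrow> 'g) \<Rightarrow> bool"
  where "separating_endos G m f \<longleftrightarrow>
    (\<forall>c<m. f c \<in> hom G G) \<and>
    (\<forall>c<m. \<forall>d<m. \<forall>x\<in>carrier G. c \<noteq> d \<longrightarrow> f c x = f d x \<longrightarrow> x = \<one>\<^bsub>G\<^esub>)"

text \<open>The maps are the multiplications by the p^a representatives. If two of them agree at x,
  primality of \<open>M\<close> makes either the two multipliers equal or x zero.\<close>

lemma (in residue_field) separating_endos_residue_group:
  obtains f where "separating_endos residue_group (p ^ a) f"
proof -
  have "finite residues" by (simp add: residues_def)
  then obtain e where e: "bij_betw e {..<p ^ a} residues"
    using ex_bij_betw_nat_finite[of residues] card_residues by (auto simp: atLeast0LessThan)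
  then have eR: "e c \<in> residues" if "c < p ^ a" for c
    using that by (auto simp: bij_betw_def)
  define f where "f c x = red (e c * x)" for c x
  have "separating_endos residue_group (p ^ a) f"
    unfolding separating_endos_def
  proof (intro conjI allI impI ballI)
    fix c assume "c < p ^ a"
    then have c: "e c \<in> A" by (intro residues_A eR)
    show "f c \<in> hom residue_group residue_group"
      using c
      by (intro homI)
        (auto simp: residue_group_def f_def red_mult_right red_add_left red_add_right red_A residues_A
          A_intros red_residues distrib_left)
  next
    fix c d x assume cd: "c < p ^ a" "d < p ^ a" "c \<noteq> d" and "x \<in> carrier residue_group"
      and eq: "f c x = f d x"
    then have x: "x \<in> residues" by (simp add: residue_group_def)
    note A = residues_A[OF x] residues_A[OF eR[OF cd(1)]] residues_A[OF eR[OF cd(2)]]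
    have "e c * x \<cong>\<^sub>M e d * x"
      using cong_red[of "e c * x"] cong_sym[OF cong_red[of "e d * x"]] eq A cong_trans
      by (auto simp: f_def A_intros)
    then have "(e c - e d) * x \<in> M" by (simp add: cong_M_def left_diff_distrib)
    then have "e c \<cong>\<^sub>M e d \<or> x \<cong>\<^sub>M 0"
      using prime_M[of "e c - e d" x] A by (auto simp: cong_M_def A_intros)
    moreover have "e c \<noteq> e d" using e cd by (auto simp: bij_betw_def inj_on_def)
    ultimately have "x \<cong>\<^sub>M 0" using residues_unique eR cd by blast
    then show "x = \<one>\<^bsub>residue_group\<^esub>"
      using residues_unique[OF x] by (simp add: residue_group_def residues_def)
  qed
  then show ?thesis by (rule that)
qed

lemma exists_separating_endos_prime_power:
  fixes p a :: nat
  assumes "prime p" "a > 0"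
  shows "\<exists>(G :: complex monoid) f.
    comm_group G \<and> card (carrier G) = p ^ a \<and> separating_endos G (p ^ a) f"
proof -
  define N where "N = p ^ a - 1"
  have "p ^ 1 \<le> p ^ a"
    using assms prime_gt_0_nat[OF assms(1)] by (intro power_increasing) auto
  then have N: "N > 0" "Suc N = p ^ a"
    using prime_ge_2_nat[OF assms(1)] by (simp_all add: N_def)
  obtain M where "cyclotomic_ideal N M" "of_nat p \<in> M" "1 \<notin> M"
    "\<And>x y. \<lbrakk>x \<in> cyclotomic_ring N; y \<in> cyclotomic_ring N; x * y \<in> M\<rbrakk> \<Longrightarrow> x \<in> M \<or> y \<in> M"
    using exists_prime_ideal_over[OF N(1) assms(1)] by metis
  then interpret residue_field p a N M
    using assms N by unfold_locales
  obtain f where "separating_endos residue_group (p ^ a) f"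
    by (rule separating_endos_residue_group)
  then show ?thesis
    using comm_group_residue_group card_residues by (auto simp: residue_group_def)
qed

section \<open>The upper bound\<close>

abbreviation tuple_group :: "nat \<Rightarrow> (nat \<Rightarrow> 'x set) \<Rightarrow> (nat \<Rightarrow> 'x \<Rightarrow> 'x) monoid"
  where "tuple_group k X \<equiv> product_group {1..k} (\<lambda>i. BijGroup (X i))"

lemma group_tuple_group: "group (tuple_group k X)"
  by (simp add: group_BijGroup)

lemma carrier_BijGroup [simp]: "carrier (BijGroup S) = Bij S"
  and one_BijGroup [simp]: "\<one>\<^bsub>BijGroup S\<^esub> = (\<lambda>x\<in>S. x)"
  by (simp_all add: BijGroup_def)

lemma mult_BijGroup [simp]:
  "\<lbrakk>f \<in> Bij S; g \<in> Bij S\<rbrakk> \<Longrightarrow> f \<otimes>\<^bsub>BijGroup S\<^esub> g = compose S f g"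
  by (simp add: BijGroup_def)

text \<open>Composition in \<open>BijGroup\<close> is restricted to \<open>X i\<close>, so the law
  needs every coordinate of \<open>r\<close> to lie there.\<close>

lemma tuple_act_mult:
  assumes "\<sigma> \<in> carrier (tuple_group k X)" "\<tau> \<in> carrier (tuple_group k X)" "r \<in> (\<Pi>\<^sub>E i\<in>{1..k}. X i)"
  shows "tuple_act k (\<sigma> \<otimes>\<^bsub>tuple_group k X\<^esub> \<tau>) r = tuple_act k \<sigma> (tuple_act k \<tau> r)"
proof (rule ext)
  fix i
  show "tuple_act k (\<sigma> \<otimes>\<^bsub>tuple_group k X\<^esub> \<tau>) r i = tuple_act k \<sigma> (tuple_act k \<tau> r) i"
  proof (cases "i \<in> {1..k}")
    case True
    then have "\<sigma> i \<in> Bij (X i)" "\<tau> i \<in> Bij (X i)" "r i \<in> X i"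
      using assms by (auto simp: PiE_iff)
    with True show ?thesis by (simp add: tuple_act_def compose_eq)
  qed (simp add: tuple_act_def del: atLeastAtMost_iff)
qed

lemma tuple_act_one:
  assumes "r \<in> (\<Pi>\<^sub>E i\<in>{1..k}. X i)"
  shows "tuple_act k \<one>\<^bsub>tuple_group k X\<^esub> r = r"
  using assms by (auto simp: tuple_act_def fun_eq_iff PiE_iff extensional_def)

section \<open>Rows of an orthogonal array and the autotopy group\<close>

context
  fixes k n :: nat and S :: "'s set" and X :: "nat \<Rightarrow> 'x set" and \<pi> :: "nat \<Rightarrow> 's \<Rightarrow> 'x"
  assumes oa: "orthogonal_array k n S X \<pi>"
begin

lemma proj_closed: "\<lbrakk>i \<in> {1..k}; s \<in> S\<rbrakk> \<Longrightarrow> \<pi> i s \<in> X i"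
  using oa by (auto simp: orthogonal_array_def)

lemma card_coordinate: "i \<in> {1..k} \<Longrightarrow> finite (X i)" "i \<in> {1..k} \<Longrightarrow> card (X i) = n"
  using oa by (simp_all add: orthogonal_array_def)

lemma oa_rows_PiE: "oa_rows k S \<pi> \<subseteq> (\<Pi>\<^sub>E i\<in>{1..k}. X i)"
  by (auto simp: oa_rows_def proj_closed)

lemma oa_row_unique:
  assumes "r \<in> oa_rows k S \<pi>" "t \<in> oa_rows k S \<pi>"
    and "i \<in> {1..k}" "j \<in> {1..k}" "i \<noteq> j" "r i = t i" "r j = t j"
  shows "r = t"
proof -
  obtain s s' where "s \<in> S" "s' \<in> S" "r = (\<lambda>i\<in>{1..k}. \<pi> i s)" "t = (\<lambda>i\<in>{1..k}. \<pi> i s')"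
    using assms by (auto simp: oa_rows_def)
  moreover have "inj_on (\<lambda>s. (\<pi> i s, \<pi> j s)) S"
    using oa assms by (auto simp: orthogonal_array_def bij_betw_def)
  ultimately show ?thesis
    using assms inj_onD[of "\<lambda>s. (\<pi> i s, \<pi> j s)" S s s'] by auto
qed

lemma oa_row_exists:
  assumes "i \<in> {1..k}" "j \<in> {1..k}" "i \<noteq> j" "x \<in> X i" "y \<in> X j"
  obtains r where "r \<in> oa_rows k S \<pi>" "r i = x" "r j = y"
proof -
  have "(\<lambda>s. (\<pi> i s, \<pi> j s)) ` S = X i \<times> X j"
    using oa assms by (auto simp: orthogonal_array_def bij_betw_def)
  then have "(x, y) \<in> (\<lambda>s. (\<pi> i s, \<pi> j s)) ` S" using assms by simp
  then obtain s where "s \<in> S" "\<pi> i s = x" "\<pi> j s = y" by blast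
  then show ?thesis
    using that[of "\<lambda>i\<in>{1..k}. \<pi> i s"] assms by (auto simp: oa_rows_def)
qed

text \<open>Since k is at least 2, the coordinates 1 and 2 exist, and they identify the rows with
  pairs.\<close>

lemma card_oa_rows:
  assumes "k \<ge> 2"
  shows "card (oa_rows k S \<pi>) = n ^ 2"
proof -
  have 12: "1 \<in> {1..k}" "2 \<in> {1..k}" using assms by auto
  have "bij_betw (\<lambda>r. (r 1, r 2)) (oa_rows k S \<pi>) (X 1 \<times> X 2)"
  proof (rule bij_betwI')
    fix r t assume "r \<in> oa_rows k S \<pi>" "t \<in> oa_rows k S \<pi>"
    then show "(r 1, r 2) = (t 1, t 2) \<longleftrightarrow> r = t" using oa_row_unique[of r t 1 2] 12 by auto
  next
    fix r assume "r \<in> oa_rows k S \<pi>"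
    then show "(r 1, r 2) \<in> X 1 \<times> X 2" using 12 oa_rows_PiE by (auto simp: PiE_iff subset_iff)
  next
    fix xy assume "xy \<in> X 1 \<times> X 2"
    then obtain x y where xy: "xy = (x, y)" "x \<in> X 1" "y \<in> X 2" by blast
    obtain r where "r \<in> oa_rows k S \<pi>" "r 1 = x" "r 2 = y"
      by (rule oa_row_exists[of 1 2 x y]) (use 12 xy in auto)
    then show "\<exists>r\<in>oa_rows k S \<pi>. xy = (r 1, r 2)" using xy by blast
  qed
  then show ?thesis
    using 12[THEN card_coordinate(2)]
    by (simp add: bij_betw_same_card card_cartesian_product power2_eq_square)
qed

lemma finite_oa_rows:
  assumes "k \<ge> 2" "n > 0"
  shows "finite (oa_rows k S \<pi>)"
  using card_oa_rows[OF assms(1)] assms(2) by (intro card_ge_0_finite) simp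

lemma subgroup_autotopy_group:
  "subgroup (carrier (autotopy_group k S X \<pi>)) (tuple_group k X)"
proof -
  let ?P = "tuple_group k X" and ?T = "oa_rows k S \<pi>"
  interpret P: group ?P by (rule group_tuple_group)
  have carr: "carrier (autotopy_group k S X \<pi>) = {\<sigma> \<in> carrier ?P. tuple_act k \<sigma> ` ?T = ?T}"
    by (simp add: autotopy_group_def Let_def)
  have mult: "tuple_act k (\<sigma> \<otimes>\<^bsub>?P\<^esub> \<tau>) ` U = tuple_act k \<sigma> ` tuple_act k \<tau> ` U"
    if "\<sigma> \<in> carrier ?P" "\<tau> \<in> carrier ?P" "U \<subseteq> ?T" for \<sigma> \<tau> U
    unfolding image_image using that oa_rows_PiE
    by (intro image_cong refl tuple_act_mult) auto
  have one: "tuple_act k \<one>\<^bsub>?P\<^esub> ` ?T = ?T"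
    using tuple_act_one oa_rows_PiE by (force simp: image_iff subset_iff)
  show ?thesis
  proof (rule P.subgroupI)
    show "carrier (autotopy_group k S X \<pi>) \<subseteq> carrier ?P" unfolding carr by blast
    have "\<one>\<^bsub>?P\<^esub> \<in> carrier (autotopy_group k S X \<pi>)"
      unfolding carr using one P.one_closed by blast
    then show "carrier (autotopy_group k S X \<pi>) \<noteq> {}" by blast
  next
    fix \<sigma> assume "\<sigma> \<in> carrier (autotopy_group k S X \<pi>)"
    then have \<sigma>: "\<sigma> \<in> carrier ?P" "tuple_act k \<sigma> ` ?T = ?T" unfolding carr by auto
    \<comment> \<open>Applying the inverse to the invariance equation of \<sigma> and cancelling
      gives the invariance equation of the inverse.\<close>
    have "tuple_act k (inv\<^bsub>?P\<^esub> \<sigma>) ` tuple_act k \<sigma> ` ?T = tuple_act k (inv\<^bsub>?P\<^esub> \<sigma> \<otimes>\<^bsub>?P\<^esub> \<sigma>) ` ?T"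
      by (rule mult[symmetric, OF P.inv_closed[OF \<sigma>(1)] \<sigma>(1) subset_refl])
    then have "tuple_act k (inv\<^bsub>?P\<^esub> \<sigma>) ` ?T = ?T"
      unfolding \<sigma>(2) P.l_inv[OF \<sigma>(1)] one .
    then show "inv\<^bsub>?P\<^esub> \<sigma> \<in> carrier (autotopy_group k S X \<pi>)"
      unfolding carr using P.inv_closed[OF \<sigma>(1)] by blast
  next
    fix \<sigma> \<tau> assume "\<sigma> \<in> carrier (autotopy_group k S X \<pi>)" "\<tau> \<in> carrier (autotopy_group k S X \<pi>)"
    then have *: "\<sigma> \<in> carrier ?P" "tuple_act k \<sigma> ` ?T = ?T" "\<tau> \<in> carrier ?P" "tuple_act k \<tau> ` ?T = ?T"
      unfolding carr by auto
    then show "\<sigma> \<otimes>\<^bsub>?P\<^esub> \<tau> \<in> carrier (autotopy_group k S X \<pi>)"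
      unfolding carr using mult[of \<sigma> \<tau> ?T] P.m_closed[of \<sigma> \<tau>] by auto
  qed
qed

lemma autotopy_group_eq:
  "autotopy_group k S X \<pi> = (tuple_group k X)\<lparr>carrier := carrier (autotopy_group k S X \<pi>)\<rparr>"
  by (simp add: autotopy_group_def Let_def)

lemma group_autotopy_group: "group (autotopy_group k S X \<pi>)"
  using subgroup.subgroup_is_group[OF subgroup_autotopy_group group_tuple_group]
  by (simp only: autotopy_group_eq[symmetric])

lemma autotopy_row:
  assumes "\<sigma> \<in> carrier (autotopy_group k S X \<pi>)" "r \<in> oa_rows k S \<pi>"
  shows "tuple_act k \<sigma> r \<in> oa_rows k S \<pi>"
  using assms by (auto simp: autotopy_group_def Let_def)

end

section \<open>Large stabilizers and the count of non-identity elements\<close>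

lemma (in group_action) exists_large_stabilizer:
  fixes p :: nat
  assumes "finite E" "prime p" "Coset.order G = p ^ (2 * a)" "\<not> p ^ Suc a dvd card E"
  shows "\<exists>x\<in>E. p ^ a \<le> card (stabilizer G \<phi> x)"
proof -
  \<comment> \<open>The orbits partition \<open>E\<close>; if p^(a+1) divided all their sizes it
    would divide \<open>card E\<close>.\<close>
  have "\<exists>x\<in>E. \<not> p ^ Suc a dvd card (orbit G \<phi> x)"
  proof (rule ccontr)
    assume "\<not> ?thesis"
    then have *: "p ^ Suc a dvd card B" if "B \<in> orbits G E \<phi>" for B
      using that by (auto simp: orbits_def)
    interpret partition E "orbits G E \<phi>" by (rule orbit_partition)
    have "card E = (\<Sum>B\<in>orbits G E \<phi>. card B)"
      using disjoint_sum[OF assms(1), of "\<lambda>_. 1 :: nat"] by simp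
    also have "p ^ Suc a dvd \<dots>" using * by (rule dvd_sum)
    finally show False using assms by simp
  qed
  then obtain x where x: "x \<in> E" "\<not> p ^ Suc a dvd card (orbit G \<phi> x)" by blast
  have eq: "card (orbit G \<phi> x) * card (stabilizer G \<phi> x) = p ^ (2 * a)"
    using orbit_stabilizer_theorem[OF x(1)] assms by simp
  \<comment> \<open>The orbit size divides a power of p, so it is p^b, and indivisibility by p^(a+1)
    gives b \<le> a. The stabilizer takes up the remaining factor, which is at least p^a.\<close>
  then have "card (orbit G \<phi> x) dvd p ^ (2 * a)" by (metis dvd_triv_left)
  then obtain b where b: "card (orbit G \<phi> x) = p ^ b"
    using assms(2) by (auto simp: divides_primepow_nat)
  then have "b \<le> a" using x(2) le_imp_power_dvd[of "Suc a" b p] by fastforce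
  then have "p ^ b \<le> p ^ a" using prime_gt_0_nat[OF assms(2)] by (intro power_increasing) auto
  then have "p ^ a * p ^ a \<le> p ^ a * card (stabilizer G \<phi> x)"
    using eq b by (metis mult.commute mult_le_mono1 mult_2 power_add)
  then show ?thesis using x(1) prime_gt_0_nat[OF assms(2)] by auto
qed

lemma simply_transitive_MOLS_bound:
  fixes S :: "'s set" and X :: "nat \<Rightarrow> 'x set" and p :: nat
  assumes mols: "simply_transitive_MOLS q n S X \<pi>" and "n > 0" and p: "prime p"
    and dvd: "p ^ a dvd n" and ndvd: "\<not> p ^ Suc a dvd n" and "a > 0"
  shows "q \<le> p ^ a - 1"
proof -
  define k where "k = q + 2"
  define T where "T = oa_rows k S \<pi>"
  define G where "G = autotopy_group k S X \<pi>"
  have k2: "k \<ge> 2" by (simp add: k_def)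
  have oa: "orthogonal_array k n S X \<pi>"
    using mols by (simp add: simply_transitive_MOLS_def k_def)
  obtain H where H: "subgroup H G"
    and simp_trans: "\<And>r t. \<lbrakk>r \<in> T; t \<in> T\<rbrakk> \<Longrightarrow> \<exists>!\<sigma>. \<sigma> \<in> H \<and> tuple_act k \<sigma> r = t"
    using mols unfolding simply_transitive_MOLS_def k_def T_def G_def by blast
  interpret G: group G unfolding G_def using oa by (rule group_autotopy_group)
  have cardT: "card T = n ^ 2" and finT: "finite T"
    using card_oa_rows[OF oa k2] finite_oa_rows[OF oa k2 \<open>n > 0\<close>] by (auto simp: T_def)
  have "T \<noteq> {}" using cardT \<open>n > 0\<close> by auto
  then obtain r0 where r0: "r0 \<in> T" by blast
  have HG: "H \<subseteq> carrier G" using H by (rule subgroup.subset)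
  have act: "tuple_act k \<sigma> r \<in> T" if "\<sigma> \<in> H" "r \<in> T" for \<sigma> r
    using autotopy_row[OF oa] that HG by (auto simp: T_def G_def)
  \<comment> \<open>Simple transitivity makes evaluation at one row a bijection, so \<open>H\<close>
    has n^2 elements.\<close>
  have bij: "bij_betw (\<lambda>\<sigma>. tuple_act k \<sigma> r0) H T"
  proof (rule bij_betwI')
    fix \<sigma> \<tau> assume "\<sigma> \<in> H" "\<tau> \<in> H"
    then show "(tuple_act k \<sigma> r0 = tuple_act k \<tau> r0) = (\<sigma> = \<tau>)"
      using simp_trans[OF r0 act[OF _ r0]] by blast
  next
    fix t assume "t \<in> T"
    then show "\<exists>\<sigma>\<in>H. t = tuple_act k \<sigma> r0" using simp_trans[OF r0] by blast
  qed (use act r0 in auto)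
  then have cardH: "card H = n ^ 2" and finH: "finite H"
    using cardT finT bij_betw_same_card bij_betw_finite by metis+
  define GH where "GH = G\<lparr>carrier := H\<rparr>"
  have GH: "group GH" unfolding GH_def using H G.is_group by (rule subgroup.subgroup_is_group)
  obtain m where m: "n = p ^ a * m" using dvd by (auto elim: dvdE)
  have "Coset.order GH = p ^ (2 * a) * m ^ 2"
    using m cardH by (simp add: Coset.order_def GH_def power_mult_distrib power_mult mult.commute flip: power_mult)
  then obtain P where "subgroup P GH" and cardP: "card P = p ^ (2 * a)"
    using sylow_thm[OF p GH, of "2 * a" "m ^ 2"] finH by (auto simp: GH_def)
  then have PG: "subgroup P G" and PH: "P \<subseteq> H"
    using G.incl_subgroup[OF H] subgroup.subset by (fastforce simp: GH_def)+
  have finP: "finite P" using PH finH by (rule finite_subset)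
  define GP where "GP = G\<lparr>carrier := P\<rparr>"
  have GP: "group GP" unfolding GP_def using PG G.is_group by (rule subgroup.subgroup_is_group)
  have comp: "\<sigma> i \<in> Bij (X i)" if "\<sigma> \<in> P" "i \<in> {1..k}" for \<sigma> i
    using that PH HG by (fastforce simp: G_def autotopy_group_def Let_def PiE_iff)
  \<comment> \<open>Reading off one coordinate is a homomorphism from the Sylow subgroup to the
    permutations of \<open>X i\<close>.\<close>
  have actX: "group_action GP (X i) (\<lambda>\<sigma>. \<sigma> i)" if i: "i \<in> {1..k}" for i
    unfolding group_action_def
  proof (rule group_hom.intro[OF GP group_BijGroup], unfold_locales, rule homI)
    fix \<sigma> \<tau> assume "\<sigma> \<in> carrier GP" "\<tau> \<in> carrier GP"
    then show "(\<sigma> \<otimes>\<^bsub>GP\<^esub> \<tau>) i = \<sigma> i \<otimes>\<^bsub>BijGroup (X i)\<^esub> \<tau> i"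
      using i by (simp add: GP_def G_def autotopy_group_def Let_def)
  qed (use comp i in \<open>auto simp: GP_def\<close>)
  have "\<exists>x\<in>X i. p ^ a \<le> card (stabilizer GP (\<lambda>\<sigma>. \<sigma> i) x)" if i: "i \<in> {1..k}" for i
  proof -
    interpret group_action GP "X i" "\<lambda>\<sigma>. \<sigma> i" using actX[OF i] .
    show ?thesis
      using card_coordinate[OF oa i] exists_large_stabilizer[OF _ p, of a] ndvd cardP by (simp add: Coset.order_def GP_def)
  qed
  then obtain x where x: "\<And>i. i \<in> {1..k} \<Longrightarrow> x i \<in> X i"
    and large: "\<And>i. i \<in> {1..k} \<Longrightarrow> p ^ a \<le> card (stabilizer GP (\<lambda>\<sigma>. \<sigma> i) (x i))"
    by metis
  \<comment> \<open>Removing the identity makes the chosen stabilizers pairwise disjoint.\<close>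
  define D where "D i = stabilizer GP (\<lambda>\<sigma>. \<sigma> i) (x i) - {\<one>\<^bsub>G\<^esub>}" for i
  have stab: "\<one>\<^bsub>G\<^esub> \<in> stabilizer GP (\<lambda>\<sigma>. \<sigma> i) (x i)" "stabilizer GP (\<lambda>\<sigma>. \<sigma> i) (x i) \<subseteq> P"
    if i: "i \<in> {1..k}" for i
  proof -
    interpret group_action GP "X i" "\<lambda>\<sigma>. \<sigma> i" using actX[OF i] .
    show "\<one>\<^bsub>G\<^esub> \<in> stabilizer GP (\<lambda>\<sigma>. \<sigma> i) (x i)"
      using stabilizer_one_closed[OF x[OF i]] by (simp add: GP_def)
    show "stabilizer GP (\<lambda>\<sigma>. \<sigma> i) (x i) \<subseteq> P"
      using stabilizer_subset by (simp add: GP_def)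
  qed
  have disj: "D i \<inter> D j = {}" if i: "i \<in> {1..k}" and j: "j \<in> {1..k}" and "i \<noteq> j" for i j
  proof -
    \<comment> \<open>A row through both chosen points is sent by a common stabilizing element to a
      row agreeing with it in two coordinates, hence to itself. The identity does the same, so
      uniqueness in \<open>simp_trans\<close> identifies the two.\<close>
    obtain r where r: "r \<in> T" "r i = x i" "r j = x j"
      using oa_row_exists[OF oa i j \<open>i \<noteq> j\<close> x[OF i] x[OF j]] unfolding T_def by blast
    have fix_r: "tuple_act k \<sigma> r = r"
      if "\<sigma> \<in> stabilizer GP (\<lambda>\<sigma>. \<sigma> i) (x i)" "\<sigma> \<in> stabilizer GP (\<lambda>\<sigma>. \<sigma> j) (x j)" for \<sigma>
    proof -
      have "\<sigma> \<in> H" "\<sigma> i (x i) = x i" "\<sigma> j (x j) = x j"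
        using that PH by (auto simp: stabilizer_def GP_def)
      then show ?thesis
        using act[of \<sigma> r] r i j \<open>i \<noteq> j\<close> unfolding T_def
        by (intro oa_row_unique[OF oa _ _ i j]) (auto simp: tuple_act_def)
    qed
    have "\<sigma> = \<one>\<^bsub>G\<^esub>"
      if "\<sigma> \<in> stabilizer GP (\<lambda>\<sigma>. \<sigma> i) (x i)" "\<sigma> \<in> stabilizer GP (\<lambda>\<sigma>. \<sigma> j) (x j)" for \<sigma>
      using simp_trans[OF r(1) r(1)] fix_r[OF that] fix_r[OF stab(1)[OF i] stab(1)[OF j]]
        that(1) stab[OF i] PH by blast
    then show ?thesis by (auto simp: D_def)
  qed
  have fin_stab: "finite (stabilizer GP (\<lambda>\<sigma>. \<sigma> i) (x i))" if "i \<in> {1..k}" for i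
    using stab(2)[OF that] finP by (rule finite_subset)
  have "k * (p ^ a - 1) = (\<Sum>i\<in>{1..k}. p ^ a - 1)" by simp
  also have "\<dots> \<le> (\<Sum>i\<in>{1..k}. card (D i))"
    unfolding D_def using large stab fin_stab by (intro sum_mono) (simp add: card_Diff_singleton diff_le_mono)
  also have "\<dots> = card (\<Union>i\<in>{1..k}. D i)"
    using disj fin_stab by (intro card_UN_disjoint[symmetric]) (auto simp: D_def)
  also have "\<dots> \<le> card (P - {\<one>\<^bsub>G\<^esub>})"
  proof (rule card_mono)
    show "(\<Union>i\<in>{1..k}. D i) \<subseteq> P - {\<one>\<^bsub>G\<^esub>}"
      unfolding D_def by (intro UN_least Diff_mono stab(2) subset_refl)
  qed (use finP in simp)
  also have "\<dots> = p ^ (2 * a) - 1"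
    using subgroup.one_closed[OF PG] finP cardP by (simp add: card_Diff_singleton)
  also have "\<dots> = (p ^ a + 1) * (p ^ a - 1)"
  proof -
    obtain b where "p ^ a = Suc b"
      using prime_gt_0_nat[OF p] by (metis gr0_implies_Suc zero_less_power)
    then show ?thesis by (simp add: mult_2 power_add)
  qed
  finally have "k * (p ^ a - 1) \<le> (p ^ a + 1) * (p ^ a - 1)" .
  moreover have "p ^ 1 \<le> p ^ a"
    using prime_gt_0_nat[OF p] \<open>a > 0\<close> by (intro power_increasing) auto
  \<comment> \<open>Positivity permits cancelling the common factor p^a - 1.\<close>
  then have "p ^ a - 1 > 0" using prime_ge_2_nat[OF p] by simp
  ultimately have "k \<le> p ^ a + 1" by (simp only: mult_le_cancel2)
  then show ?thesis by (simp add: k_def)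
qed

section \<open>The construction\<close>

text \<open>Rows are the elements of \<open>W\<close>, coordinate \<open>i\<close> is
  \<open>\<phi> i\<close>, and \<open>W\<close> acts by left translation on rows and through
  \<open>\<phi> i\<close> on the copy of \<open>G\<close> at coordinate \<open>i\<close>. Trivial
  common kernels of two coordinates give orthogonality.\<close>

lemma simply_transitive_MOLS_of_homs:
  fixes W :: "('w, 'c) monoid_scheme" and G :: "('g, 'b) monoid_scheme"
    and \<phi> :: "nat \<Rightarrow> 'w \<Rightarrow> 'g"
  assumes "group W" "group G" and cW: "card (carrier W) = n ^ 2" and cG: "card (carrier G) = n"
    and "n > 0"
    and hom: "\<And>i. i \<in> {1..q + 2} \<Longrightarrow> \<phi> i \<in> hom W G"
    and ker: "\<And>i j w. \<lbrakk>i \<in> {1..q + 2}; j \<in> {1..q + 2}; i \<noteq> j; w \<in> carrier W;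
      \<phi> i w = \<one>\<^bsub>G\<^esub>; \<phi> j w = \<one>\<^bsub>G\<^esub>\<rbrakk> \<Longrightarrow> w = \<one>\<^bsub>W\<^esub>"
  shows "\<exists>(S :: nat set) (X :: nat \<Rightarrow> nat set) \<pi>. simply_transitive_MOLS q n S X \<pi>"
proof -
  interpret W: group W by fact
  interpret G: group G by fact
  define k where "k = q + 2"
  have homs: "group_hom W G (\<phi> i)" if "i \<in> {1..k}" for i
    using hom that by (unfold_locales) (auto simp: k_def)
  have \<phi>_closed: "\<phi> i w \<in> carrier G" if "i \<in> {1..k}" "w \<in> carrier W" for i w
    using group_hom.hom_closed[OF homs] that by blast
  have \<phi>_mult: "\<phi> i (w \<otimes>\<^bsub>W\<^esub> u) = \<phi> i w \<otimes>\<^bsub>G\<^esub> \<phi> i u"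
    if "i \<in> {1..k}" "w \<in> carrier W" "u \<in> carrier W" for i w u
    using group_hom.hom_mult[OF homs] that by blast
  have \<phi>_inj: "w = u"
    if ij: "i \<in> {1..k}" "j \<in> {1..k}" "i \<noteq> j" and wu: "w \<in> carrier W" "u \<in> carrier W"
      and eq: "\<phi> i w = \<phi> i u" "\<phi> j w = \<phi> j u" for i j w u
  proof -
    have "\<phi> l (w \<otimes>\<^bsub>W\<^esub> inv\<^bsub>W\<^esub> u) = \<one>\<^bsub>G\<^esub>" if "l \<in> {1..k}" "\<phi> l w = \<phi> l u" for l
      using that wu group_hom.hom_inv[OF homs[OF that(1)] wu(2)]
      by (simp add: \<phi>_mult[OF that(1)] \<phi>_closed[OF that(1)])
    \<comment> \<open>The quotient of the two elements lies in both kernels.\<close>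
    from this[OF ij(1) eq(1)] this[OF ij(2) eq(2)]
    have "w \<otimes>\<^bsub>W\<^esub> inv\<^bsub>W\<^esub> u = \<one>\<^bsub>W\<^esub>"
      by (rule ker[OF ij(1,2)[unfolded k_def] ij(3) W.m_closed[OF wu(1) W.inv_closed[OF wu(2)]]])
    then show ?thesis using wu W.inv_equality[of w "inv\<^bsub>W\<^esub> u"] by simp
  qed
  have "finite (carrier G)" "finite (carrier W)"
    using cG cW \<open>n > 0\<close> by (auto intro: card_ge_0_finite)
  \<comment> \<open>Enumerations transport \<open>G\<close> and \<open>W\<close> to initial segments
    of the natural numbers, the type asked for in the conclusion.\<close>
  then obtain h b where h: "bij_betw h (carrier G) {..<n}" and b: "bij_betw b {..<n ^ 2} (carrier W)"
    using ex_bij_betw_finite_nat[of "carrier G"] ex_bij_betw_nat_finite[of "carrier W"] cG cW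
    by (auto simp: atLeast0LessThan)
  define h' where "h' = inv_into (carrier G) h"
  have h'h: "h' (h g) = g" if "g \<in> carrier G" for g
    using h that by (simp add: h'_def bij_betw_def)
  have hh': "h (h' z) = z" "h' z \<in> carrier G" if "z < n" for z
    using h that by (auto simp: h'_def bij_betw_def f_inv_into_f inv_into_into)
  have h_less: "h g < n" if "g \<in> carrier G" for g
    using h that by (auto simp: bij_betw_def)
  have h_inj: "h g = h g' \<longleftrightarrow> g = g'" if "g \<in> carrier G" "g' \<in> carrier G" for g g'
    using h'h that by metis
  have b_closed: "b s \<in> carrier W" if "s < n ^ 2" for s
    using b that by (auto simp: bij_betw_def)

  define S where "S = {..<n ^ 2}"
  define X :: "nat \<Rightarrow> nat set" where "X = (\<lambda>_. {..<n})"
  define \<pi> where "\<pi> i s = h (\<phi> i (b s))" for i s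
  have oa: "orthogonal_array k n S X \<pi>"
    unfolding orthogonal_array_def
  proof (intro conjI ballI impI)
    fix i j assume ij: "i \<in> {1..k}" "j \<in> {1..k}" "i \<noteq> j"
    have inj: "inj_on (\<lambda>s. (\<pi> i s, \<pi> j s)) S"
    proof (rule inj_onI)
      fix s s' assume s: "s \<in> S" "s' \<in> S" and "(\<pi> i s, \<pi> j s) = (\<pi> i s', \<pi> j s')"
      then have "\<phi> i (b s) = \<phi> i (b s')" "\<phi> j (b s) = \<phi> j (b s')"
        using ij by (auto simp: \<pi>_def S_def h_inj \<phi>_closed b_closed simp del: atLeastAtMost_iff)
      then have "b s = b s'" using \<phi>_inj ij s by (auto simp: S_def b_closed)
      then show "s = s'" using b s by (auto simp: bij_betw_def inj_on_def S_def)
    qed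
    \<comment> \<open>An injective map between finite sets of size n^2 is onto.\<close>
    moreover have "(\<lambda>s. (\<pi> i s, \<pi> j s)) ` S = X i \<times> X j"
    proof (rule card_subset_eq)
      show "(\<lambda>s. (\<pi> i s, \<pi> j s)) ` S \<subseteq> X i \<times> X j"
        using ij by (auto simp: \<pi>_def S_def X_def h_less \<phi>_closed b_closed simp del: atLeastAtMost_iff)
      show "card ((\<lambda>s. (\<pi> i s, \<pi> j s)) ` S) = card (X i \<times> X j)"
        by (simp add: card_image[OF inj]) (simp add: S_def X_def power2_eq_square)
    qed (simp add: X_def)
    ultimately show "bij_betw (\<lambda>s. (\<pi> i s, \<pi> j s)) S (X i \<times> X j)"
      by (simp add: bij_betw_def)
  qed (auto simp: X_def S_def \<pi>_def h_less \<phi>_closed b_closed simp del: atLeastAtMost_iff)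

  define row where "row w = (\<lambda>i\<in>{1..k}. h (\<phi> i w))" for w
  have rows: "oa_rows k S \<pi> = row ` carrier W"
  proof -
    have "carrier W = b ` S" using b by (simp add: bij_betw_def S_def)
    then show ?thesis by (simp add: oa_rows_def row_def \<pi>_def image_image)
  qed
  have row_inj: "w = u" if "w \<in> carrier W" "u \<in> carrier W" "row w = row u" for w u
  proof -
    have 12: "1 \<in> {1..k}" "2 \<in> {1..k}" by (auto simp: k_def)
    have "\<phi> i w = \<phi> i u" if "i \<in> {1..k}" for i
      using fun_cong[OF \<open>row w = row u\<close>, of i] that \<open>w \<in> carrier W\<close> \<open>u \<in> carrier W\<close>
      by (simp add: row_def h_inj \<phi>_closed del: atLeastAtMost_iff)
    then show ?thesis using \<phi>_inj[of 1 2 w u] 12 that by auto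
  qed

  \<comment> \<open>Left translation by \<open>g\<close>, transported along \<open>h\<close> and
    restricted so that it belongs to \<open>Bij\<close>.\<close>
  define \<rho> where "\<rho> g = (\<lambda>z\<in>{..<n}. h (g \<otimes>\<^bsub>G\<^esub> h' z))" for g
  have \<rho>_mult: "\<rho> (g \<otimes>\<^bsub>G\<^esub> g') = compose {..<n} (\<rho> g) (\<rho> g')"
    if "g \<in> carrier G" "g' \<in> carrier G" for g g'
    using that by (auto simp: \<rho>_def compose_def fun_eq_iff h_less h'h hh' G.m_assoc)
  have \<rho>_h: "\<rho> g (h g') = h (g \<otimes>\<^bsub>G\<^esub> g')" if "g \<in> carrier G" "g' \<in> carrier G" for g g'
    using that by (simp add: \<rho>_def h_less h'h)
  have \<rho>_Bij: "\<rho> g \<in> Bij {..<n}" if g: "g \<in> carrier G" for g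
  proof -
    have "bij_betw (\<rho> g) {..<n} {..<n}"
    proof (rule bij_betw_byWitness[where f' = "\<rho> (inv\<^bsub>G\<^esub> g)"])
      show "\<forall>z\<in>{..<n}. \<rho> (inv\<^bsub>G\<^esub> g) (\<rho> g z) = z"
        using g by (auto simp: \<rho>_def h_less h'h hh' G.m_assoc[symmetric])
      show "\<forall>z\<in>{..<n}. \<rho> g (\<rho> (inv\<^bsub>G\<^esub> g) z) = z"
        using g by (auto simp: \<rho>_def h_less h'h hh' G.m_assoc[symmetric])
    qed (use g in \<open>auto simp: \<rho>_def h_less hh'\<close>)
    then show ?thesis by (simp add: Bij_def \<rho>_def)
  qed
  define \<sigma> where "\<sigma> w = (\<lambda>i\<in>{1..k}. \<rho> (\<phi> i w))" for w
  have act: "tuple_act k (\<sigma> w) (row u) = row (w \<otimes>\<^bsub>W\<^esub> u)"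
    if "w \<in> carrier W" "u \<in> carrier W" for w u
    unfolding tuple_act_def \<sigma>_def row_def
    by (rule restrict_ext) (use that in \<open>simp add: \<rho>_h \<phi>_closed \<phi>_mult del: atLeastAtMost_iff\<close>)
  define A where "A = autotopy_group k S X \<pi>"
  have A: "group A" unfolding A_def using oa by (rule group_autotopy_group)
  have "\<sigma> \<in> hom W A"
  proof (rule homI)
    fix w assume w: "w \<in> carrier W"
    have "tuple_act k (\<sigma> w) ` row ` carrier W = row ` (\<lambda>u. w \<otimes>\<^bsub>W\<^esub> u) ` carrier W"
      using w by (simp add: image_image act)
    also have "(\<lambda>u. w \<otimes>\<^bsub>W\<^esub> u) ` carrier W = carrier W"
      using W.surj_const_mult[OF w] .
    finally have "tuple_act k (\<sigma> w) ` oa_rows k S \<pi> = oa_rows k S \<pi>" by (simp add: rows)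
    moreover have "\<sigma> w \<in> (\<Pi>\<^sub>E i\<in>{1..k}. Bij (X i))"
      unfolding \<sigma>_def X_def using \<rho>_Bij \<phi>_closed w by (intro restrict_PiE_iff[THEN iffD2]) blast
    ultimately show "\<sigma> w \<in> carrier A"
      by (simp add: A_def autotopy_group_def Let_def)
  next
    fix w u assume wu: "w \<in> carrier W" "u \<in> carrier W"
    have "\<sigma> (w \<otimes>\<^bsub>W\<^esub> u) = (\<lambda>i\<in>{1..k}. \<sigma> w i \<otimes>\<^bsub>BijGroup (X i)\<^esub> \<sigma> u i)"
      unfolding \<sigma>_def
      by (rule restrict_ext)
        (use wu in \<open>simp add: \<phi>_mult \<phi>_closed \<rho>_mult \<rho>_Bij X_def del: atLeastAtMost_iff\<close>)
    then show "\<sigma> (w \<otimes>\<^bsub>W\<^esub> u) = \<sigma> w \<otimes>\<^bsub>A\<^esub> \<sigma> u"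
      by (simp add: A_def autotopy_group_def Let_def)
  qed
  then interpret \<sigma>: group_hom W A \<sigma>
    using A by (intro group_hom.intro group_hom_axioms.intro) (auto intro: W.is_group)
  have "subgroup (\<sigma> ` carrier W) A" by (rule \<sigma>.img_is_subgroup)
  moreover have "\<exists>!\<tau>. \<tau> \<in> \<sigma> ` carrier W \<and> tuple_act k \<tau> r = t"
    if "r \<in> oa_rows k S \<pi>" "t \<in> oa_rows k S \<pi>" for r t
  proof -
    obtain u where u: "u \<in> carrier W" "r = row u"
      using \<open>r \<in> oa_rows k S \<pi>\<close> unfolding rows by auto
    obtain v where v: "v \<in> carrier W" "t = row v"
      using \<open>t \<in> oa_rows k S \<pi>\<close> unfolding rows by auto
    note uv = u(1) v(1) u(2) v(2)
    show ?thesis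
    \<comment> \<open>The only element of \<open>W\<close> whose left translation takes u to v is v
      u^-1. Injectivity of \<open>row\<close> carries this over to rows.\<close>
    proof (rule ex1I[of _ "\<sigma> (v \<otimes>\<^bsub>W\<^esub> inv\<^bsub>W\<^esub> u)"])
      show "\<sigma> (v \<otimes>\<^bsub>W\<^esub> inv\<^bsub>W\<^esub> u) \<in> \<sigma> ` carrier W \<and> tuple_act k (\<sigma> (v \<otimes>\<^bsub>W\<^esub> inv\<^bsub>W\<^esub> u)) r = t"
      proof
        have vu: "v \<otimes>\<^bsub>W\<^esub> inv\<^bsub>W\<^esub> u \<in> carrier W" using uv by simp
        then show "\<sigma> (v \<otimes>\<^bsub>W\<^esub> inv\<^bsub>W\<^esub> u) \<in> \<sigma> ` carrier W" by (rule imageI)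
        show "tuple_act k (\<sigma> (v \<otimes>\<^bsub>W\<^esub> inv\<^bsub>W\<^esub> u)) r = t"
          unfolding uv(3) act[OF vu uv(1)] using uv by (simp add: W.m_assoc)
      qed
    next
      fix \<tau> assume \<tau>: "\<tau> \<in> \<sigma> ` carrier W \<and> tuple_act k \<tau> r = t"
      then obtain w where w: "w \<in> carrier W" "\<tau> = \<sigma> w" by blast
      then have "row (w \<otimes>\<^bsub>W\<^esub> u) = row v" using \<tau> uv by (simp add: act)
      then have "w \<otimes>\<^bsub>W\<^esub> u = v" using row_inj w uv by auto
      then have "w = v \<otimes>\<^bsub>W\<^esub> inv\<^bsub>W\<^esub> u" using w uv by (metis W.inv_solve_right)
      then show "\<tau> = \<sigma> (v \<otimes>\<^bsub>W\<^esub> inv\<^bsub>W\<^esub> u)" using w by simp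
    qed
  qed
  ultimately have "simply_transitive_MOLS q n S X \<pi>"
    using oa unfolding simply_transitive_MOLS_def k_def A_def by blast
  then show ?thesis by blast
qed

text \<open>On pairs (x, y) the coordinates are the m products of \<open>f c x\<close> with y,
  together with x itself. Commutativity makes the products homomorphisms.\<close>

lemma simply_transitive_MOLS_of_separating_endos:
  fixes G :: "('g, 'b) monoid_scheme"
  assumes "comm_group G" "card (carrier G) = n" "n > 0" "m > 0" and f: "separating_endos G m f"
  shows "\<exists>(S :: nat set) (X :: nat \<Rightarrow> nat set) \<pi>. simply_transitive_MOLS (m - 1) n S X \<pi>"
proof -
  interpret comm_group G by fact
  have homs: "group_hom G G (f c)" if "c < m" for c
    using f that by unfold_locales (auto simp: separating_endos_def)
  have f_closed: "f c x \<in> carrier G" if "c < m" "x \<in> carrier G" for c x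
    using group_hom.hom_closed[OF homs] that by blast
  have f_mult: "f c (x \<otimes>\<^bsub>G\<^esub> y) = f c x \<otimes>\<^bsub>G\<^esub> f c y" if "c < m" "x \<in> carrier G" "y \<in> carrier G" for c x y
    using group_hom.hom_mult[OF homs] that by blast
  have f_one: "f c \<one>\<^bsub>G\<^esub> = \<one>\<^bsub>G\<^esub>" if "c < m" for c
    using group_hom.hom_one[OF homs] that by blast
  have sep: "x = \<one>\<^bsub>G\<^esub>" if "c < m" "d < m" "c \<noteq> d" "x \<in> carrier G" "f c x = f d x" for c d x
    using f that unfolding separating_endos_def by blast
  \<comment> \<open>Array coordinates start at 1 and endomorphism indices at 0, hence the shift. As
    m > 0, there are m + 1 coordinates, and only the last one reads off x.\<close>
  define \<phi> where "\<phi> i w = (if i \<le> m then f (i - 1) (fst w) \<otimes>\<^bsub>G\<^esub> snd w else fst w)" for i w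
  have less: "i - 1 < m" if "i \<in> {1..m - 1 + 2}" "i \<le> m" for i
    using that by auto
  show ?thesis
  proof (rule simply_transitive_MOLS_of_homs[where W = "G \<times>\<times> G" and G = G and \<phi> = \<phi>])
    show "group (G \<times>\<times> G)" by (intro DirProd_group is_group)
    show "card (carrier (G \<times>\<times> G)) = n ^ 2"
      using assms by (simp add: card_cartesian_product power2_eq_square)
    fix i assume i: "i \<in> {1..m - 1 + 2}"
    show "\<phi> i \<in> hom (G \<times>\<times> G) G"
      using less[OF i]
      by (intro homI) (auto simp: \<phi>_def f_closed f_mult m_ac)
  next
    fix i j w
    assume i: "i \<in> {1..m - 1 + 2}" and j: "j \<in> {1..m - 1 + 2}" and "i \<noteq> j"
      and "w \<in> carrier (G \<times>\<times> G)" and i1: "\<phi> i w = \<one>\<^bsub>G\<^esub>" and j1: "\<phi> j w = \<one>\<^bsub>G\<^esub>"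
    then obtain x y where w: "w = (x, y)" "x \<in> carrier G" "y \<in> carrier G" by auto
    have x: "x = \<one>\<^bsub>G\<^esub>"
    \<comment> \<open>Two coordinates of product type allow cancelling y and then separation;
      otherwise one of the two is x itself.\<close>
    proof (cases "i \<le> m \<and> j \<le> m")
      case True
      then have "f (i - 1) x \<otimes>\<^bsub>G\<^esub> y = f (j - 1) x \<otimes>\<^bsub>G\<^esub> y"
        using i1 j1 w by (simp add: \<phi>_def)
      then have "f (i - 1) x = f (j - 1) x" using w True less i j by (simp add: f_closed)
      moreover have "i - 1 \<noteq> j - 1" using \<open>i \<noteq> j\<close> i j by auto
      ultimately show ?thesis using sep[of "i - 1" "j - 1" x] less i j True w by blast
    qed (use i1 j1 w in \<open>auto simp: \<phi>_def split: if_splits\<close>)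
    have y: "f (l - 1) x \<otimes>\<^bsub>G\<^esub> y = \<one>\<^bsub>G\<^esub> \<Longrightarrow> y = \<one>\<^bsub>G\<^esub>" if "l \<in> {1..m - 1 + 2}" "l \<le> m" for l
      using f_one[OF less[OF that]] x w by simp
    have "i \<le> m \<or> j \<le> m" using i j \<open>i \<noteq> j\<close> \<open>m > 0\<close> by auto
    then have "y = \<one>\<^bsub>G\<^esub>" using y[OF i] y[OF j] i1 j1 w by (auto simp: \<phi>_def)
    then show "w = \<one>\<^bsub>G \<times>\<times> G\<^esub>" using w x by simp
  qed (use assms is_group in auto)
qed

lemma separating_endos_mono: "\<lbrakk>separating_endos G m f; l \<le> m\<rbrakk> \<Longrightarrow> separating_endos G l f"
  unfolding separating_endos_def by (meson order_less_le_trans)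

text \<open>The maps act componentwise, so agreement of two of them at x is agreement in every
  component. All factors share the index range c < m, which is why the smallest prime power limits
  m.\<close>

lemma separating_endos_product_group:
  assumes "\<And>i. i \<in> I \<Longrightarrow> separating_endos (G i) m (f i)"
  shows "separating_endos (product_group I G) m (\<lambda>c x. \<lambda>i\<in>I. f i c (x i))"
  unfolding separating_endos_def
proof (intro conjI allI impI ballI)
  fix c assume "c < m"
  then have "f i c \<in> hom (G i) (G i)" if "i \<in> I" for i
    using assms that by (auto simp: separating_endos_def)
  then show "(\<lambda>x. \<lambda>i\<in>I. f i c (x i)) \<in> hom (product_group I G) (product_group I G)"
    by (intro homI) (auto simp: hom_def Pi_iff PiE_iff intro!: restrict_ext)
next
  fix c d x assume *: "c < m" "d < m" "c \<noteq> d" "x \<in> carrier (product_group I G)"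
    "(\<lambda>i\<in>I. f i c (x i)) = (\<lambda>i\<in>I. f i d (x i))"
  have "x i = \<one>\<^bsub>G i\<^esub>" if i: "i \<in> I" for i
  proof -
    have "f i c (x i) = f i d (x i)" using fun_cong[OF *(5), of i] i by simp
    moreover have "x i \<in> carrier (G i)" using *(4) i by auto
    ultimately show ?thesis using assms[OF i] *(1-3) unfolding separating_endos_def by blast
  qed
  then show "x = \<one>\<^bsub>product_group I G\<^esub>"
    using *(4) by (auto simp: PiE_iff extensional_def fun_eq_iff)
qed

text \<open>One residue field is taken for each prime dividing n, its family of multiplications is
  cut down to m maps, and the additive groups are multiplied together.\<close>

lemma exists_separating_endos:
  fixes n m :: nat
  assumes "n > 0" and m: "\<And>p. p \<in> prime_factors n \<Longrightarrow> m \<le> p ^ multiplicity p n"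
  shows "\<exists>(G :: (nat \<Rightarrow> complex) monoid) f.
    comm_group G \<and> card (carrier G) = n \<and> separating_endos G m f"
proof -
  have "\<exists>(G :: complex monoid) f. comm_group G \<and> card (carrier G) = p ^ multiplicity p n \<and>
      separating_endos G (p ^ multiplicity p n) f" if "p \<in> prime_factors n" for p
    using that by (intro exists_separating_endos_prime_power)
      (auto simp: prime_factors_multiplicity)
  then obtain G :: "nat \<Rightarrow> complex monoid" and f
    where G: "\<And>p. p \<in> prime_factors n \<Longrightarrow> comm_group (G p)"
      and card: "\<And>p. p \<in> prime_factors n \<Longrightarrow> card (carrier (G p)) = p ^ multiplicity p n"
      and f: "\<And>p. p \<in> prime_factors n \<Longrightarrow> separating_endos (G p) (p ^ multiplicity p n) (f p)"
    by metis
  have "comm_group (product_group (prime_factors n) G)"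
  proof (rule group.group_comm_groupI)
    show "group (product_group (prime_factors n) G)"
      using G by (intro product_group) (simp add: comm_group_def)
  qed (use G in \<open>auto intro!: restrict_ext comm_monoid.m_comm simp: comm_group_def PiE_iff\<close>)
  moreover have "card (carrier (product_group (prime_factors n) G)) = n"
    using card prime_factorization_nat[OF assms(1)] by (simp add: card_PiE)
  moreover have "separating_endos (product_group (prime_factors n) G) m
      (\<lambda>c x. \<lambda>p\<in>prime_factors n. f p c (x p))"
    using separating_endos_mono f m by (intro separating_endos_product_group) blast
  ultimately show ?thesis by blast
qed

section \<open>Combining both bounds at the smallest prime power\<close>

theorem theorem4p6:
  fixes n m :: nat
  assumes "n \<ge> 2"
    and "m = Min ((\<lambda>p. p ^ multiplicity p n) ` prime_factors n)"
  shows "(\<exists>(S :: nat set) (X :: nat \<Rightarrow> nat set) \<pi>. simply_transitive_MOLS (m - 1) n S X \<pi>) \<and>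
    (\<forall>q (S :: 's set) (X :: nat \<Rightarrow> 'x set) \<pi>. simply_transitive_MOLS q n S X \<pi> \<longrightarrow> q \<le> m - 1)"
proof (intro conjI allI impI)
  let ?Q = "(\<lambda>p. p ^ multiplicity p n) ` prime_factors n"
  have "prime_factors n \<noteq> {}" using assms(1) by (auto simp: prime_factorization_empty_iff)
  then have "m \<in> ?Q" and min: "\<And>p. p \<in> prime_factors n \<Longrightarrow> m \<le> p ^ multiplicity p n"
    unfolding assms(2) by (auto intro!: Min_in Min_le)
  \<comment> \<open>The prime attaining the minimum is the one at which the upper bound is
    applied.\<close>
  then obtain p where p: "p \<in> prime_factors n" "m = p ^ multiplicity p n" by blast
  then have prime: "prime p" by auto
  have "m > 0" using p prime_gt_0_nat[OF prime] by simp
  obtain G :: "(nat \<Rightarrow> complex) monoid" and f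
    where "comm_group G" "card (carrier G) = n" "separating_endos G m f"
    using exists_separating_endos[of n m] min assms(1) by auto
  then show "\<exists>(S :: nat set) (X :: nat \<Rightarrow> nat set) \<pi>. simply_transitive_MOLS (m - 1) n S X \<pi>"
    using assms(1) \<open>m > 0\<close> by (intro simply_transitive_MOLS_of_separating_endos) auto
  fix q and S :: "'s set" and X :: "nat \<Rightarrow> 'x set" and \<pi>
  assume mols: "simply_transitive_MOLS q n S X \<pi>"
  have "\<not> p ^ Suc (multiplicity p n) dvd n"
    using prime assms(1) power_dvd_iff_le_multiplicity[of n p "Suc (multiplicity p n)"]
      prime_gt_1_nat[OF prime] by (auto simp del: power_Suc)
  then show "q \<le> m - 1"
    unfolding p(2)
    using p prime assms(1) mols
    by (intro simply_transitive_MOLS_bound[OF mols])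
      (auto simp: multiplicity_dvd prime_factors_multiplicity)
qed

end
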